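(* Let $H$ be a graph with chromatic number $r+1\ge 3$. Then there is a least positive integer $g$ such that $H$ is not homomorphic to $K_{r-2}+C_{2g+1}$, and furthermore \[ 1-\frac{1}{r-1} < 1-\frac{1}{r-1+2/(2g-1)} \le \delta_H \le 1-\frac{1}{r-1/3}. \]
   Context: All graphs are finite and simple. $K_m$ is the complete graph on $m$ vertices ($K_0$ is empty), $C_m$ the $m$-cycle; the join $G+F$ is obtained from disjoint copies of $G$ and $F$ by joining every vertex of $G$ to every vertex of $F$. $H$ is homomorphic to $F$ if there is a map $V(H)\to V(F)$ sending edges to edges. $\delta(G)$ is minimum degree; $G$ is $H$-free if it contains no subgraph isomorphic to $H$. For a graph $H$ of chromatic number $r+1$, $\delta_H$ is the infimum of all $c$ such that for every $\eta>0$ there is $n_0$ such that every $H$-free graph $G$ on $n\ge n_0$ vertices with $\delta(G)\ge cn$ can be made $r$-partite by deleting at most $\eta n^2$ edges. *)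

theory Defs
  imports Complex_Main "HOL-Library.Ramsey"
begin

record 'a graph =
  verts :: "'a set"
  edges :: "'a set set"

definition simple_graph :: "'a graph \<Rightarrow> bool" where
  "simple_graph G \<longleftrightarrow> finite (verts G) \<and> edges G \<subseteq> nsets (verts G) 2"

definition complete_graph :: "nat \<Rightarrow> nat graph" where
  "complete_graph m = \<lparr>verts = {..<m}, edges = nsets {..<m} 2\<rparr>"

text \<open>The \<open>m\<close>-cycle, meaningful for \<open>m \<ge> 3\<close>.\<close>

definition cycle_graph :: "nat \<Rightarrow> nat graph" where
  "cycle_graph m = \<lparr>verts = {..<m}, edges = {{i, (i + 1) mod m} | i. i < m}\<rparr>"

definition graph_join :: "'a graph \<Rightarrow> 'b graph \<Rightarrow> ('a + 'b) graph" where
  "graph_join G F = \<lparr>verts = verts G <+> verts F,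
     edges = (image Inl) ` edges G \<union> (image Inr) ` edges F
       \<union> {{Inl u, Inr v} | u v. u \<in> verts G \<and> v \<in> verts F}\<rparr>"

definition homomorphic :: "'a graph \<Rightarrow> 'b graph \<Rightarrow> bool" where
  "homomorphic H F \<longleftrightarrow>
     (\<exists>f. f ` verts H \<subseteq> verts F \<and> (\<forall>u v. {u, v} \<in> edges H \<longrightarrow> {f u, f v} \<in> edges F))"

definition isomorphic :: "'a graph \<Rightarrow> 'b graph \<Rightarrow> bool" where
  "isomorphic H F \<longleftrightarrow>
     (\<exists>f. bij_betw f (verts H) (verts F) \<and>
          (\<forall>u\<in>verts H. \<forall>v\<in>verts H. {u, v} \<in> edges H \<longleftrightarrow> {f u, f v} \<in> edges F))"

definition subgraph_of :: "'a graph \<Rightarrow> 'a graph \<Rightarrow> bool" where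
  "subgraph_of F G \<longleftrightarrow> simple_graph F \<and> verts F \<subseteq> verts G \<and> edges F \<subseteq> edges G"

definition graph_free :: "'a graph \<Rightarrow> 'b graph \<Rightarrow> bool" where
  "graph_free H G \<longleftrightarrow> \<not> (\<exists>F. subgraph_of F G \<and> isomorphic H F)"

definition degree :: "'a graph \<Rightarrow> 'a \<Rightarrow> nat" where
  "degree G v = card {u \<in> verts G. {u, v} \<in> edges G}"

definition min_degree :: "'a graph \<Rightarrow> nat" where
  "min_degree G = Min (degree G ` verts G)"

text \<open>Colour classes are allowed to be empty.\<close>

definition partite :: "nat \<Rightarrow> 'a graph \<Rightarrow> bool" where
  "partite k G \<longleftrightarrow>
     (\<exists>c. c ` verts G \<subseteq> {..<k} \<and> (\<forall>u v. {u, v} \<in> edges G \<longrightarrow> c u \<noteq> c v))"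

definition chromatic_number :: "'a graph \<Rightarrow> nat" where
  "chromatic_number G = (LEAST k. partite k G)"

definition partite_after_deleting :: "nat \<Rightarrow> real \<Rightarrow> 'a graph \<Rightarrow> bool" where
  "partite_after_deleting r m G \<longleftrightarrow>
     (\<exists>D \<subseteq> edges G. real (card D) \<le> m \<and> partite r (G\<lparr>edges := edges G - D\<rparr>))"

text \<open>
  Every finite graph is isomorphic to one with vertices in \<^typ>\<open>nat\<close>, so
  host graphs \<open>G\<close> range over \<^typ>\<open>nat graph\<close>. The number \<open>r\<close> of parts is one less than the
  chromatic number of \<open>H\<close>. The value of \<^const>\<open>min_degree\<close> at the graph without vertices
  is irrelevant, since that graph is \<open>r\<close>-partite.
\<close>

definition delta_threshold :: "'a graph \<Rightarrow> real" where
  "delta_threshold H = Inf {c :: real. \<forall>\<eta>>0. \<exists>n\<^sub>0 :: nat. \<forall>G :: nat graph.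
     simple_graph G \<longrightarrow> graph_free H G \<longrightarrow> card (verts G) \<ge> n\<^sub>0 \<longrightarrow>
     real (min_degree G) \<ge> c * real (card (verts G)) \<longrightarrow>
     partite_after_deleting (chromatic_number H - 1) (\<eta> * (real (card (verts G)))\<^sup>2) G}"

end

theory Submission
  imports Defs
begin

text \<open>
  Lower bound: a blow-up of \<open>K\<^sub>r\<^sub>-\<^sub>2 + C\<^sub>2\<^sub>g\<^sub>+\<^sub>1\<close>, weighted so as to be regular, is \<open>H\<close>-free, has the
  claimed density and, since \<open>K\<^sub>r\<^sub>-\<^sub>2 + C\<^sub>2\<^sub>g\<^sub>+\<^sub>1\<close> is not \<open>r\<close>-partite, is far from being \<open>r\<close>-partite.

  Upper bound: an \<open>H\<close>-free graph contains no large complete \<open>(r + 1)\<close>-partite subgraph, hence by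
  Erdos' theorem only few copies of \<open>K\<^sub>r\<^sub>+\<^sub>1\<close>. Instead of the removal lemma, a random sample of bounded
  size is used: together with two further random vertices \<open>u\<close>, \<open>v\<close> it typically spans a graph
  without \<open>K\<^sub>r\<^sub>+\<^sub>1\<close> whose minimum degree exceeds the Andrasfai-Erdos-Sos bound, and is therefore
  \<open>r\<close>-partite. The \<open>r\<close>-colouring of the sample is unique up to renaming, so it determines the colour
  of each typical vertex of the whole graph, and a typical edge \<open>uv\<close> receives two different colours.
\<close>

section \<open>Simple graphs\<close>

definition adjacent :: "'a graph \<Rightarrow> 'a \<Rightarrow> 'a \<Rightarrow> bool" where
  "adjacent G u v \<longleftrightarrow> {u, v} \<in> edges G"

definition neighbours :: "'a graph \<Rightarrow> 'a \<Rightarrow> 'a set" where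
  "neighbours G v = {u \<in> verts G. adjacent G v u}"

definition nonneighbours :: "'a graph \<Rightarrow> 'a \<Rightarrow> 'a set" where
  "nonneighbours G v = {u \<in> verts G. \<not> adjacent G v u}"

lemma adjacent_commute: "adjacent G u v \<longleftrightarrow> adjacent G v u"
  by (simp add: adjacent_def insert_commute)

lemma simple_graph_finite_verts: "simple_graph G \<Longrightarrow> finite (verts G)"
  by (simp add: simple_graph_def)

lemma simple_graph_finite_edges: "simple_graph G \<Longrightarrow> finite (edges G)"
  unfolding simple_graph_def by (blast intro: finite_subset finite_imp_finite_nsets)

lemma simple_graph_adjacentD:
  assumes "simple_graph G" "adjacent G u v"
  shows "u \<in> verts G" "v \<in> verts G" "u \<noteq> v"
proof -
  have "{u, v} \<in> nsets (verts G) 2"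
    using assms unfolding simple_graph_def adjacent_def by blast
  then show "u \<in> verts G" "v \<in> verts G" "u \<noteq> v" by simp_all
qed

lemma simple_graph_edgeE:
  assumes "simple_graph G" "e \<in> edges G"
  obtains u v where "e = {u, v}" "adjacent G u v"
  using assms unfolding simple_graph_def adjacent_def by (metis nsets2_E subsetD)

lemma finite_neighbours: "simple_graph G \<Longrightarrow> finite (neighbours G v)"
  and finite_nonneighbours: "simple_graph G \<Longrightarrow> finite (nonneighbours G v)"
  by (simp_all add: neighbours_def nonneighbours_def simple_graph_finite_verts)

lemma degree_eq_card_neighbours: "degree G v = card (neighbours G v)"
  by (simp add: degree_def neighbours_def adjacent_def insert_commute)

lemma degree_add_card_nonneighbours:
  assumes "simple_graph G"
  shows "degree G v + card (nonneighbours G v) = card (verts G)"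
proof -
  have "verts G = neighbours G v \<union> nonneighbours G v"
    by (auto simp: neighbours_def nonneighbours_def)
  moreover have "neighbours G v \<inter> nonneighbours G v = {}"
    by (auto simp: neighbours_def nonneighbours_def)
  ultimately show ?thesis
    using assms
    by (simp add: degree_eq_card_neighbours card_Un_disjoint finite_neighbours finite_nonneighbours)
qed

lemma min_degree_le_degree: "simple_graph G \<Longrightarrow> v \<in> verts G \<Longrightarrow> min_degree G \<le> degree G v"
  unfolding min_degree_def by (simp add: simple_graph_finite_verts)

subsection \<open>Homomorphisms\<close>

definition graph_hom :: "('a \<Rightarrow> 'b) \<Rightarrow> 'a graph \<Rightarrow> 'b graph \<Rightarrow> bool" where
  "graph_hom f H G \<longleftrightarrow>
     f ` verts H \<subseteq> verts G \<and> (\<forall>u v. adjacent H u v \<longrightarrow> adjacent G (f u) (f v))"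

lemma homomorphic_iff_graph_hom: "homomorphic H G \<longleftrightarrow> (\<exists>f. graph_hom f H G)"
  by (simp add: homomorphic_def graph_hom_def adjacent_def)

lemma graph_hom_comp: "graph_hom f H G \<Longrightarrow> graph_hom g G F \<Longrightarrow> graph_hom (\<lambda>v. g (f v)) H F"
  by (simp add: graph_hom_def image_subset_iff)

definition image_graph :: "('a \<Rightarrow> 'b) \<Rightarrow> 'a graph \<Rightarrow> 'b graph" where
  "image_graph f H = \<lparr>verts = f ` verts H, edges = image f ` edges H\<rparr>"

lemma simple_image_graph:
  assumes "simple_graph H" "inj_on f (verts H)"
  shows "simple_graph (image_graph f H)"
proof -
  have "f ` e \<in> nsets (f ` verts H) 2" if edge: "e \<in> edges H" for e
  proof -
    obtain u v where "e = {u, v}" "adjacent H u v"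
      using simple_graph_edgeE[OF assms(1) edge] .
    then show ?thesis
      using simple_graph_adjacentD[OF assms(1)] inj_on_eq_iff[OF assms(2)] by simp
  qed
  then show ?thesis
    using assms(1) by (auto simp: simple_graph_def image_graph_def)
qed

lemma isomorphic_image_graph:
  assumes "simple_graph H" "inj_on f (verts H)"
  shows "isomorphic H (image_graph f H)"
proof -
  have "{u, v} \<in> edges H \<longleftrightarrow> {f u, f v} \<in> image f ` edges H" if "u \<in> verts H" "v \<in> verts H" for u v
  proof -
    have "edges H \<subseteq> Pow (verts H)"
      using assms(1) by (auto simp: simple_graph_def nsets_def)
    then have "f ` {u, v} \<in> image f ` edges H \<longleftrightarrow> {u, v} \<in> edges H"
      using that by (intro inj_on_image_mem_iff[OF inj_on_image_Pow[OF assms(2)]]) auto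
    then show ?thesis by simp
  qed
  moreover have "bij_betw f (verts H) (f ` verts H)"
    using assms(2) by (rule inj_on_imp_bij_betw)
  ultimately show ?thesis
    unfolding isomorphic_def image_graph_def graph.simps by blast
qed

lemma graph_free_iff_no_inj_hom:
  assumes "simple_graph H"
  shows "graph_free H G \<longleftrightarrow> \<not> (\<exists>f. graph_hom f H G \<and> inj_on f (verts H))"
proof -
  have "\<exists>f. graph_hom f H G \<and> inj_on f (verts H)" if subgraph: "subgraph_of F G" "isomorphic H F" for F
  proof -
    obtain f where iso: "bij_betw f (verts H) (verts F)"
      "\<And>u v. u \<in> verts H \<Longrightarrow> v \<in> verts H \<Longrightarrow> {u, v} \<in> edges H \<longleftrightarrow> {f u, f v} \<in> edges F"
      using subgraph(2) unfolding isomorphic_def by blast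
    then have "adjacent G (f u) (f v)" if "adjacent H u v" for u v
      using subgraph(1) that simple_graph_adjacentD[OF assms that]
      unfolding subgraph_of_def adjacent_def by blast
    moreover have "f ` verts H \<subseteq> verts G"
      using iso(1) subgraph(1) by (simp add: bij_betw_def subgraph_of_def)
    ultimately show ?thesis
      using iso(1) unfolding graph_hom_def bij_betw_def by blast
  qed
  moreover have "subgraph_of (image_graph f H) G" if "graph_hom f H G" "inj_on f (verts H)" for f
  proof -
    have "f ` e \<in> edges G" if edge: "e \<in> edges H" for e
    proof -
      obtain u v where "e = {u, v}" "adjacent H u v"
        using simple_graph_edgeE[OF assms edge] .
      then show ?thesis
        using \<open>graph_hom f H G\<close> by (simp add: graph_hom_def adjacent_def)
    qed
    then show ?thesis
      using that simple_image_graph[OF assms that(2)]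
      by (auto simp: subgraph_of_def image_graph_def graph_hom_def)
  qed
  ultimately show ?thesis
    unfolding graph_free_def using isomorphic_image_graph[OF assms] by blast
qed

subsection \<open>Pullbacks\<close>

text \<open>With \<open>h\<close> the identity this is the subgraph induced by \<open>A\<close>; with large fibres it is a blow-up of
  \<open>G\<close>; with \<open>h\<close> a tuple of vertices and \<open>A\<close> its index set it is a sample of \<open>G\<close> with repetitions.\<close>

definition pullback_graph :: "'b graph \<Rightarrow> ('a \<Rightarrow> 'b) \<Rightarrow> 'a set \<Rightarrow> 'a graph" where
  "pullback_graph G h A =
     \<lparr>verts = A, edges = {{a, b} | a b. a \<in> A \<and> b \<in> A \<and> adjacent G (h a) (h b)}\<rparr>"

abbreviation induced_subgraph :: "'a graph \<Rightarrow> 'a set \<Rightarrow> 'a graph" where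
  "induced_subgraph G A \<equiv> pullback_graph G (\<lambda>v. v) A"

lemma verts_pullback_graph [simp]: "verts (pullback_graph G h A) = A"
  by (simp add: pullback_graph_def)

lemma adjacent_pullback_graph [simp]:
  "adjacent (pullback_graph G h A) a b \<longleftrightarrow> a \<in> A \<and> b \<in> A \<and> adjacent G (h a) (h b)"
  by (auto simp: adjacent_def pullback_graph_def doubleton_eq_iff insert_commute)

lemma pullback_graph_cong:
  "(\<And>a. a \<in> A \<Longrightarrow> h a = h' a) \<Longrightarrow> pullback_graph G h A = pullback_graph G h' A"
  by (simp add: pullback_graph_def cong: conj_cong)

lemma simple_pullback_graph:
  assumes "simple_graph G" "finite A"
  shows "simple_graph (pullback_graph G h A)"
  using simple_graph_adjacentD(3)[OF assms(1)] assms(2)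
  by (fastforce simp: simple_graph_def pullback_graph_def)

lemma graph_hom_pullback_graph: "h ` A \<subseteq> verts G \<Longrightarrow> graph_hom h (pullback_graph G h A) G"
  by (simp add: graph_hom_def)

lemma graph_free_pullback_graph:
  assumes "simple_graph H" "\<not> homomorphic H G" "h ` A \<subseteq> verts G"
  shows "graph_free H (pullback_graph G h A)"
  using assms(2) graph_hom_comp[OF _ graph_hom_pullback_graph[OF assms(3)]]
  by (auto simp: graph_free_iff_no_inj_hom[OF assms(1)] homomorphic_iff_graph_hom)

subsection \<open>Colourings\<close>

definition proper_colouring :: "'a graph \<Rightarrow> 'c set \<Rightarrow> ('a \<Rightarrow> 'c) \<Rightarrow> bool" where
  "proper_colouring G C c \<longleftrightarrow> c ` verts G \<subseteq> C \<and> (\<forall>u v. adjacent G u v \<longrightarrow> c u \<noteq> c v)"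

lemma proper_colouring_in: "proper_colouring G C c \<Longrightarrow> v \<in> verts G \<Longrightarrow> c v \<in> C"
  by (auto simp: proper_colouring_def)

lemma proper_colouring_neq: "proper_colouring G C c \<Longrightarrow> adjacent G u v \<Longrightarrow> c u \<noteq> c v"
  by (auto simp: proper_colouring_def)

lemma partite_iff_proper_colouring: "partite k G \<longleftrightarrow> (\<exists>c. proper_colouring G {..<k} c)"
  by (simp add: partite_def proper_colouring_def adjacent_def)

lemma proper_colouring_recolour:
  assumes "simple_graph G" "proper_colouring G C c" "finite C" "finite D" "card C \<le> card D"
  obtains d where "proper_colouring G D d"
proof -
  obtain f where injection: "f ` C \<subseteq> D" "inj_on f C"
    using card_le_inj[OF assms(3-5)] by blast
  have "proper_colouring G D (f \<circ> c)"
    unfolding proper_colouring_def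
  proof (intro conjI allI impI)
    show "(f \<circ> c) ` verts G \<subseteq> D"
      using assms(2) injection(1) by (auto simp: proper_colouring_def)
    show "(f \<circ> c) u \<noteq> (f \<circ> c) v" if "adjacent G u v" for u v
      using simple_graph_adjacentD[OF assms(1) that] assms(2) that inj_on_eq_iff[OF injection(2)]
      by (auto simp: proper_colouring_def image_subset_iff)
  qed
  then show ?thesis using that by blast
qed

lemma partite_if_proper_colouring:
  assumes "simple_graph G" "proper_colouring G C c" "finite C" "card C \<le> k"
  shows "partite k G"
  using proper_colouring_recolour[OF assms(1-3), of "{..<k}"] assms(4)
  by (auto simp: partite_iff_proper_colouring)

lemma partite_card_verts: "simple_graph G \<Longrightarrow> partite (card (verts G)) G"
  using simple_graph_adjacentD(3)[of G] simple_graph_finite_verts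
  by (intro partite_if_proper_colouring[of G "verts G" "\<lambda>v. v"]) (auto simp: proper_colouring_def)

lemma proper_colouring_graph_hom:
  "graph_hom f H G \<Longrightarrow> proper_colouring G C c \<Longrightarrow> proper_colouring H C (\<lambda>v. c (f v))"
  by (simp add: graph_hom_def proper_colouring_def image_subset_iff)

lemma partite_graph_hom: "graph_hom f H G \<Longrightarrow> partite k G \<Longrightarrow> partite k H"
  unfolding partite_iff_proper_colouring using proper_colouring_graph_hom by blast

subsection \<open>Cliques\<close>

definition is_clique :: "'a graph \<Rightarrow> 'a set \<Rightarrow> bool" where
  "is_clique G K \<longleftrightarrow> K \<subseteq> verts G \<and> clique K (edges G)"

definition clique_free :: "nat \<Rightarrow> 'a graph \<Rightarrow> bool" where
  "clique_free k G \<longleftrightarrow> \<not> (\<exists>K. is_clique G K \<and> card K = k)"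

lemma is_clique_adjacent: "is_clique G K \<Longrightarrow> u \<in> K \<Longrightarrow> v \<in> K \<Longrightarrow> u \<noteq> v \<Longrightarrow> adjacent G u v"
  by (simp add: is_clique_def clique_def adjacent_def)

lemma is_clique_subset: "is_clique G K \<Longrightarrow> L \<subseteq> K \<Longrightarrow> is_clique G L"
  unfolding is_clique_def using smaller_clique by blast

lemma is_clique_finite: "simple_graph G \<Longrightarrow> is_clique G K \<Longrightarrow> finite K"
  unfolding is_clique_def using finite_subset simple_graph_finite_verts by blast

lemma is_clique_insert:
  "is_clique G (insert v K) \<longleftrightarrow> v \<in> verts G \<and> (\<forall>u\<in>K. u \<noteq> v \<longrightarrow> adjacent G v u) \<and> is_clique G K"
  by (auto simp: is_clique_def clique_def adjacent_def insert_commute)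

lemma clique_free_card_le:
  assumes "clique_free (Suc r) G" "is_clique G K"
  shows "card K \<le> r"
proof (rule ccontr)
  assume "\<not> card K \<le> r"
  then obtain L where "L \<subseteq> K" "card L = Suc r"
    by (metis not_less_eq_eq obtain_subset_with_card_n)
  then show False
    using assms is_clique_subset unfolding clique_free_def by blast
qed

lemma clique_free_nonadjacentE:
  assumes "simple_graph G" "clique_free (Suc r) G" "is_clique G K" "card K = r" "v \<in> verts G"
  obtains u where "u \<in> K" "\<not> adjacent G v u"
proof (cases "v \<in> K")
  case True
  then show ?thesis using that simple_graph_adjacentD(3)[OF assms(1)] by blast
next
  case False
  then have "card (insert v K) = Suc r"
    using assms(4) is_clique_finite[OF assms(1,3)] by simp
  then have "\<not> is_clique G (insert v K)"
    using assms(2) unfolding clique_free_def by blast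
  then show ?thesis using that assms(3,5) by (auto simp: is_clique_insert)
qed

section \<open>The Andrasfai--Erdos--Sos theorem\<close>

text \<open>Every vertex has more than \<open>(3r - 4) / (3r - 1) * card (verts G)\<close> neighbours.\<close>

locale dense_graph =
  fixes G :: "'a graph" and r m :: nat
  assumes simple: "simple_graph G"
    and card_nonneighbours_le: "v \<in> verts G \<Longrightarrow> card (nonneighbours G v) \<le> m"
    and few_nonneighbours: "(3 * r - 1) * m < 3 * card (verts G)"

lemma sum_card_nonneighbours_swap:
  assumes "simple_graph G" "Z \<subseteq> verts G"
  shows "(\<Sum>v\<in>verts G. card (Z \<inter> nonneighbours G v)) = (\<Sum>z\<in>Z. card (nonneighbours G z))"
proof -
  have "finite (verts G)" "finite Z"
    using assms simple_graph_finite_verts finite_subset by blast+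
  then have "(\<Sum>v\<in>verts G. card {z \<in> Z. \<not> adjacent G v z}) = (\<Sum>z\<in>Z. card (nonneighbours G z))"
    by (rule sum_multicount_gen) (simp add: nonneighbours_def adjacent_commute)
  moreover have "Z \<inter> nonneighbours G v = {z \<in> Z. \<not> adjacent G v z}" for v
    using assms(2) by (auto simp: nonneighbours_def)
  ultimately show ?thesis by simp
qed

definition completing_clique :: "'a graph \<Rightarrow> nat \<Rightarrow> 'a \<Rightarrow> 'a \<Rightarrow> 'a set \<Rightarrow> bool" where
  "completing_clique G r x y A \<longleftrightarrow>
     is_clique G A \<and> Suc (card A) = r \<and> A \<subseteq> neighbours G x \<inter> neighbours G y"

definition clique_saturated :: "'a graph \<Rightarrow> nat \<Rightarrow> bool" where
  "clique_saturated G r \<longleftrightarrow> clique_free (Suc r) G \<and>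
     (\<forall>x\<in>verts G. \<forall>y\<in>verts G. x \<noteq> y \<longrightarrow> \<not> adjacent G x y \<longrightarrow> (\<exists>A. completing_clique G r x y A))"

lemma completing_clique_exchange:
  assumes "simple_graph G" "completing_clique G r x y A" "a \<in> A" "v \<in> verts G" "v \<notin> A - {a}"
    and "adjacent G v x" "adjacent G v y" "\<forall>w\<in>A - {a}. adjacent G v w"
  shows "completing_clique G r x y (insert v (A - {a}))"
proof -
  have A_clique: "is_clique G A" "Suc (card A) = r" "A \<subseteq> neighbours G x \<inter> neighbours G y"
    using assms(2) by (simp_all add: completing_clique_def)
  have "finite A"
    using assms(1) A_clique(1) by (rule is_clique_finite)
  then have "card (insert v (A - {a})) = card A"
    using card_Suc_Diff1[of A a] assms(3,5) by simp
  moreover have "is_clique G (insert v (A - {a}))"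
    using is_clique_subset[OF A_clique(1)] assms(4,8) by (simp add: is_clique_insert)
  ultimately show ?thesis
    using A_clique assms(4,6,7) by (auto simp: completing_clique_def neighbours_def adjacent_commute)
qed

text \<open>Brandt's argument that non-adjacency is transitive: the maximality of \<open>core\<close> is contradicted by
  exchanging a vertex into both \<open>A\<^sub>1\<close> and \<open>A\<^sub>2\<close>, unless every vertex misses weight at least 3 of the
  total weight at most \<open>3r - 1\<close>, where the vertices of \<open>core\<close> weigh 3 and those of \<open>support - core\<close>
  weigh 1.\<close>

locale brandt_configuration =
  fixes G :: "'a graph" and r :: nat and y x\<^sub>1 x\<^sub>2 :: 'a and A\<^sub>1 A\<^sub>2 :: "'a set"
  assumes simple: "simple_graph G" and clique_free: "clique_free (Suc r) G"
    and in_verts: "y \<in> verts G" "x\<^sub>1 \<in> verts G" "x\<^sub>2 \<in> verts G"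
    and nonadjacent_apexes: "\<not> adjacent G y x\<^sub>1" "\<not> adjacent G y x\<^sub>2"
    and adjacent_apexes: "adjacent G x\<^sub>1 x\<^sub>2"
    and completing: "completing_clique G r y x\<^sub>1 A\<^sub>1" "completing_clique G r y x\<^sub>2 A\<^sub>2"
    and maximal: "completing_clique G r y x\<^sub>1 B\<^sub>1 \<Longrightarrow> completing_clique G r y x\<^sub>2 B\<^sub>2 \<Longrightarrow>
      card (B\<^sub>1 \<inter> B\<^sub>2) \<le> card (A\<^sub>1 \<inter> A\<^sub>2)"
begin

definition core :: "'a set" where "core = A\<^sub>1 \<inter> A\<^sub>2"

definition support :: "'a set" where "support = A\<^sub>1 \<union> A\<^sub>2 \<union> {y, x\<^sub>1, x\<^sub>2}"

lemma cliques: "is_clique G A\<^sub>1" "is_clique G A\<^sub>2"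
  and Suc_card: "Suc (card A\<^sub>1) = r" "Suc (card A\<^sub>2) = r"
  and adjacent_y: "a \<in> A\<^sub>1 \<union> A\<^sub>2 \<Longrightarrow> adjacent G y a"
  and adjacent_x: "a \<in> A\<^sub>1 \<Longrightarrow> adjacent G x\<^sub>1 a" "a \<in> A\<^sub>2 \<Longrightarrow> adjacent G x\<^sub>2 a"
  using completing by (auto simp: completing_clique_def neighbours_def)

lemma finite_cliques: "finite A\<^sub>1" "finite A\<^sub>2"
  using cliques is_clique_finite[OF simple] by blast+

lemma apex_notin: "x\<^sub>1 \<notin> A\<^sub>1 \<union> A\<^sub>2" "x\<^sub>2 \<notin> A\<^sub>1 \<union> A\<^sub>2" "y \<notin> A\<^sub>1 \<union> A\<^sub>2"
  using nonadjacent_apexes adjacent_y simple_graph_adjacentD(3)[OF simple] by blast+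

lemma apex_distinct: "y \<noteq> x\<^sub>1" "y \<noteq> x\<^sub>2" "x\<^sub>1 \<noteq> x\<^sub>2"
  using nonadjacent_apexes adjacent_apexes simple_graph_adjacentD(3)[OF simple] adjacent_commute[of G]
  by blast+

lemma support_subset: "support \<subseteq> verts G" and core_subset: "core \<subseteq> support"
  using cliques in_verts by (auto simp: support_def core_def is_clique_def)

lemma finite_support: "finite support"
  using finite_cliques by (simp add: support_def)

lemma nonadjacent_in_extension:
  assumes "v \<in> verts G"
  shows "\<exists>a\<in>insert x\<^sub>1 A\<^sub>1. \<not> adjacent G v a" "\<exists>a\<in>insert x\<^sub>2 A\<^sub>2. \<not> adjacent G v a"
    "\<exists>a\<in>insert y A\<^sub>1. \<not> adjacent G v a" "\<exists>a\<in>insert y A\<^sub>2. \<not> adjacent G v a"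
proof -
  have "\<exists>a\<in>insert x A. \<not> adjacent G v a"
    if "is_clique G A" "Suc (card A) = r" "x \<in> verts G" "x \<notin> A" "\<And>a. a \<in> A \<Longrightarrow> adjacent G x a" for x A
  proof -
    have "is_clique G (insert x A)" "card (insert x A) = r"
      using that is_clique_finite[OF simple] by (auto simp: is_clique_insert)
    then show ?thesis
      using clique_free_nonadjacentE[OF simple clique_free _ _ assms] by metis
  qed
  from this[OF cliques(1) Suc_card(1)] this[OF cliques(2) Suc_card(2)]
  show "\<exists>a\<in>insert x\<^sub>1 A\<^sub>1. \<not> adjacent G v a" "\<exists>a\<in>insert x\<^sub>2 A\<^sub>2. \<not> adjacent G v a"
    "\<exists>a\<in>insert y A\<^sub>1. \<not> adjacent G v a" "\<exists>a\<in>insert y A\<^sub>2. \<not> adjacent G v a"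
    using in_verts apex_notin adjacent_x adjacent_y by blast+
qed

lemma card_core_le: "card core + 2 \<le> r"
proof -
  have "A\<^sub>1 \<noteq> A\<^sub>2"
  proof
    assume "A\<^sub>1 = A\<^sub>2"
    then have "\<forall>a\<in>insert x\<^sub>1 A\<^sub>1. adjacent G x\<^sub>2 a"
      using adjacent_x(2) adjacent_apexes by (auto simp: adjacent_commute)
    then show False
      using nonadjacent_in_extension(1)[OF in_verts(3)] by blast
  qed
  moreover have "card A\<^sub>1 = card A\<^sub>2"
    using Suc_card by simp
  ultimately have "\<not> A\<^sub>1 \<subseteq> A\<^sub>2"
    using card_subset_eq[OF finite_cliques(2)] by blast
  then have "core \<subset> A\<^sub>1"
    unfolding core_def by blast
  then have "card core < card A\<^sub>1"
    using finite_cliques(1) by (rule psubset_card_mono[rotated])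
  then show ?thesis
    using Suc_card(1) by simp
qed

lemma card_support: "card support + card core = 2 * r + 1"
proof -
  have "card support = card (A\<^sub>1 \<union> A\<^sub>2) + card {y, x\<^sub>1, x\<^sub>2}"
    unfolding support_def using finite_cliques apex_notin by (intro card_Un_disjoint) auto
  moreover have "card {y, x\<^sub>1, x\<^sub>2} = 3"
    using apex_distinct by simp
  moreover have "card A\<^sub>1 + card A\<^sub>2 = card (A\<^sub>1 \<union> A\<^sub>2) + card core"
    unfolding core_def using finite_cliques by (rule card_Un_Int)
  ultimately show ?thesis
    using Suc_card by simp
qed

lemma support_nonneighbours_neq:
  assumes v_in: "v \<in> verts G" and a_in: "a \<in> A\<^sub>1 - A\<^sub>2" and b_in: "b \<in> A\<^sub>2 - A\<^sub>1"
  shows "support \<inter> nonneighbours G v \<noteq> {a, b}"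
proof
  assume missed: "support \<inter> nonneighbours G v = {a, b}"
  have adjacent_rest: "adjacent G v w" if "w \<in> support - {a, b}" for w
    using missed that support_subset by (auto simp: nonneighbours_def)
  have apexes: "{y, x\<^sub>1, x\<^sub>2} \<subseteq> support - {a, b}"
    using a_in b_in apex_notin by (auto simp: support_def)
  have v_notin: "v \<notin> support - {a, b}"
    using adjacent_rest simple_graph_adjacentD(3)[OF simple] by blast
  let ?B\<^sub>1 = "insert v (A\<^sub>1 - {a})" and ?B\<^sub>2 = "insert v (A\<^sub>2 - {b})"
  have "completing_clique G r y x\<^sub>1 ?B\<^sub>1"
    using a_in b_in v_notin apexes by (intro completing_clique_exchange[OF simple completing(1) _ v_in])
      (auto intro!: adjacent_rest simp: support_def)
  moreover have "completing_clique G r y x\<^sub>2 ?B\<^sub>2"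
    using a_in b_in v_notin apexes by (intro completing_clique_exchange[OF simple completing(2) _ v_in])
      (auto intro!: adjacent_rest simp: support_def)
  ultimately have "card (?B\<^sub>1 \<inter> ?B\<^sub>2) \<le> card core"
    unfolding core_def by (rule maximal)
  moreover have "card (insert v core) \<le> card (?B\<^sub>1 \<inter> ?B\<^sub>2)"
    using a_in b_in finite_cliques unfolding core_def by (intro card_mono) auto
  moreover have "v \<notin> core"
    using v_notin a_in b_in by (auto simp: core_def support_def)
  ultimately show False
    using finite_cliques(1) by (simp add: core_def)
qed

lemma card_support_nonneighbours_ge:
  assumes v_in: "v \<in> verts G" and core_adjacent: "core \<inter> nonneighbours G v = {}"
  shows "3 \<le> card (support \<inter> nonneighbours G v)"
proof (rule ccontr)
  let ?M = "support \<inter> nonneighbours G v"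
  assume "\<not> 3 \<le> card ?M"
  then have small: "card ?M \<le> 2" by simp
  have finite: "finite ?M"
    using finite_support by blast
  have M_iff: "w \<in> ?M \<longleftrightarrow> w \<in> support \<and> \<not> adjacent G v w" for w
    using support_subset by (auto simp: nonneighbours_def)
  obtain a b a' b' where a_missed: "a \<in> insert x\<^sub>1 A\<^sub>1" "\<not> adjacent G v a"
    and b_missed: "b \<in> insert x\<^sub>2 A\<^sub>2" "\<not> adjacent G v b"
    and a'_missed: "a' \<in> insert y A\<^sub>1" "\<not> adjacent G v a'"
    and b'_missed: "b' \<in> insert y A\<^sub>2" "\<not> adjacent G v b'"
    using nonadjacent_in_extension[OF v_in] by blast
  have missed_notin_core: "w \<notin> core" if "\<not> adjacent G v w" for w
    using that core_adjacent M_iff core_subset by blast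
  then have "a \<noteq> b"
    using a_missed b_missed apex_notin apex_distinct by (auto simp: core_def)
  moreover have ab_missed: "{a, b} \<subseteq> ?M"
    using a_missed b_missed M_iff by (auto simp: support_def)
  ultimately have missed_eq: "?M = {a, b}"
    using card_seteq[OF finite ab_missed] small by simp
  then have "y \<notin> ?M"
    using a_missed b_missed apex_notin apex_distinct by auto
  then have "a' \<in> A\<^sub>1" "b' \<in> A\<^sub>2"
    using a'_missed b'_missed M_iff by (auto simp: support_def)
  moreover have "a' \<in> {a, b}" "b' \<in> {a, b}"
    unfolding missed_eq[symmetric] M_iff using a'_missed b'_missed \<open>a' \<in> A\<^sub>1\<close> \<open>b' \<in> A\<^sub>2\<close>
    by (auto simp: support_def)
  ultimately have "a \<in> A\<^sub>1 - A\<^sub>2" "b \<in> A\<^sub>2 - A\<^sub>1"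
    using a_missed b_missed apex_notin missed_notin_core[OF a_missed(2)] missed_notin_core[OF b_missed(2)]
      missed_notin_core[OF a'_missed(2)] missed_notin_core[OF b'_missed(2)]
    by (auto simp: core_def)
  then show False
    using support_nonneighbours_neq[OF v_in] missed_eq by blast
qed

lemma missed_weight_ge:
  assumes "v \<in> verts G"
  shows "3 \<le> card (support \<inter> nonneighbours G v) + 2 * card (core \<inter> nonneighbours G v)"
proof (cases "core \<inter> nonneighbours G v = {}")
  case True
  then show ?thesis
    using card_support_nonneighbours_ge[OF assms] by simp
next
  case False
  have finite: "finite (support \<inter> nonneighbours G v)"
    using finite_support by blast
  have "core \<inter> nonneighbours G v \<subseteq> support \<inter> nonneighbours G v"
    using core_subset by blast
  then have "card (core \<inter> nonneighbours G v) \<le> card (support \<inter> nonneighbours G v)"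
    "finite (core \<inter> nonneighbours G v)"
    using finite card_mono finite_subset by blast+
  moreover from this have "0 < card (core \<inter> nonneighbours G v)"
    using False by (simp add: card_gt_0_iff)
  ultimately show ?thesis by simp
qed

lemma not_dense: "\<not> dense_graph G r m"
proof
  assume "dense_graph G r m"
  then interpret dense_graph G r m .
  have missed: "(\<Sum>v\<in>verts G. card (Z \<inter> nonneighbours G v)) \<le> card Z * m" if "Z \<subseteq> verts G" for Z
    using sum_bounded_above[of Z "\<lambda>z. card (nonneighbours G z)" m] card_nonneighbours_le that
    by (simp add: sum_card_nonneighbours_swap[OF simple that] subset_iff)
  have "3 * card (verts G)
      \<le> (\<Sum>v\<in>verts G. card (support \<inter> nonneighbours G v) + 2 * card (core \<inter> nonneighbours G v))"
    using sum_bounded_below[OF missed_weight_ge] by (simp add: mult.commute)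
  also have "\<dots> \<le> card support * m + 2 * (card core * m)"
    using missed[of support] missed[of core] support_subset order_trans[OF core_subset support_subset]
    by (simp add: sum.distrib flip: sum_distrib_left)
  also have "\<dots> = (card support + 2 * card core) * m"
    by (simp add: algebra_simps)
  also have "\<dots> \<le> (3 * r - 1) * m"
    using card_support card_core_le by (intro mult_right_mono) auto
  finally show False
    using few_nonneighbours by simp
qed

end

lemma nonadjacent_trans:
  assumes "dense_graph G r m" "clique_saturated G r"
    and "y \<in> verts G" "x\<^sub>1 \<in> verts G" "x\<^sub>2 \<in> verts G" "\<not> adjacent G y x\<^sub>1" "\<not> adjacent G y x\<^sub>2"
  shows "\<not> adjacent G x\<^sub>1 x\<^sub>2"
proof
  assume x_adjacent: "adjacent G x\<^sub>1 x\<^sub>2"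
  interpret dense_graph G r m by fact
  have "y \<noteq> x\<^sub>1" "y \<noteq> x\<^sub>2"
    using x_adjacent assms(6,7) adjacent_commute[of G x\<^sub>1 x\<^sub>2] by blast+
  then obtain C\<^sub>1 C\<^sub>2 where initial_cliques: "completing_clique G r y x\<^sub>1 C\<^sub>1" "completing_clique G r y x\<^sub>2 C\<^sub>2"
    using assms(2-7) unfolding clique_saturated_def by blast
  define P where "P = (\<lambda>(A\<^sub>1, A\<^sub>2). completing_clique G r y x\<^sub>1 A\<^sub>1 \<and> completing_clique G r y x\<^sub>2 A\<^sub>2)"
  have "card (A\<^sub>1 \<inter> A\<^sub>2) < r" if "P (A\<^sub>1, A\<^sub>2)" for A\<^sub>1 A\<^sub>2
  proof -
    have "is_clique G A\<^sub>1" "Suc (card A\<^sub>1) = r"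
      using that by (simp_all add: P_def completing_clique_def)
    then show ?thesis
      using card_mono[of A\<^sub>1 "A\<^sub>1 \<inter> A\<^sub>2"] is_clique_finite[OF simple] by fastforce
  qed
  then obtain A\<^sub>1 A\<^sub>2 where "P (A\<^sub>1, A\<^sub>2)"
    and "\<And>B\<^sub>1 B\<^sub>2. P (B\<^sub>1, B\<^sub>2) \<Longrightarrow> card (B\<^sub>1 \<inter> B\<^sub>2) \<le> card (A\<^sub>1 \<inter> A\<^sub>2)"
    using ex_has_greatest_nat[of P "(C\<^sub>1, C\<^sub>2)" "\<lambda>(A\<^sub>1, A\<^sub>2). card (A\<^sub>1 \<inter> A\<^sub>2)" r] initial_cliques
    by (auto simp: P_def)
  then interpret brandt_configuration G r y x\<^sub>1 x\<^sub>2 A\<^sub>1 A\<^sub>2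
    using x_adjacent assms(2-7) simple by unfold_locales (auto simp: P_def clique_saturated_def)
  show False
    using not_dense assms(1) by blast
qed

lemma completing_clique_if_edge_creates_clique:
  assumes G_clique_free: "simple_graph G" "clique_free (Suc r) G"
    and xy_in: "x \<in> verts G" "y \<in> verts G" "x \<noteq> y"
    and K_clique: "is_clique (G\<lparr>edges := insert {x, y} (edges G)\<rparr>) K" "card K = Suc r"
  shows "completing_clique G r x y (K - {x, y})"
proof -
  have K_verts: "K \<subseteq> verts G"
    using K_clique(1) by (simp add: is_clique_def)
  have K_adjacent: "adjacent G u v" if "u \<in> K" "v \<in> K" "u \<noteq> v" "{u, v} \<noteq> {x, y}" for u v
    using K_clique(1) that by (auto simp: is_clique_def clique_def adjacent_def)
  have "x \<in> K" "y \<in> K"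
  proof -
    have "\<not> is_clique G K"
      using clique_free_card_le[OF G_clique_free(2)] K_clique(2) by fastforce
    then obtain u v where "u \<in> K" "v \<in> K" "u \<noteq> v" "\<not> adjacent G u v"
      using K_verts by (auto simp: is_clique_def clique_def adjacent_def)
    then have "{u, v} = {x, y}" using K_adjacent by blast
    with \<open>u \<in> K\<close> \<open>v \<in> K\<close> show "x \<in> K" "y \<in> K" by (auto simp: doubleton_eq_iff)
  qed
  moreover have "finite K"
    using K_clique(2) by (simp add: card_ge_0_finite)
  ultimately have "card K = card (K - {x, y}) + 2"
    using xy_in(3) card_Diff_subset[of "{x, y}" K] card_mono[of K "{x, y}"] by simp
  moreover have "is_clique G (K - {x, y})"
    using K_adjacent K_verts by (auto simp: is_clique_def clique_def adjacent_def doubleton_eq_iff)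
  moreover have "K - {x, y} \<subseteq> neighbours G x \<inter> neighbours G y"
    using K_adjacent[OF \<open>x \<in> K\<close>] K_adjacent[OF \<open>y \<in> K\<close>] K_verts
    by (auto simp: neighbours_def doubleton_eq_iff)
  ultimately show ?thesis
    using K_clique(2) by (simp add: completing_clique_def)
qed

lemma clique_saturated_supergraph:
  assumes "simple_graph G" "clique_free (Suc r) G"
  obtains G' where "simple_graph G'" "verts G' = verts G" "edges G \<subseteq> edges G'" "clique_saturated G' r"
proof -
  let ?graph = "\<lambda>F. G\<lparr>edges := F\<rparr>"
  define \<F> where "\<F> = {F. F \<subseteq> nsets (verts G) 2 \<and> clique_free (Suc r) (?graph F)}"
  have "finite \<F>" "edges G \<in> \<F>"
    using assms by (auto simp: \<F>_def simple_graph_def finite_imp_finite_nsets)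
  from finite_has_maximal2[OF this]
  obtain F where F_in: "F \<in> \<F>" "edges G \<subseteq> F" and F_maximal: "\<forall>F'\<in>\<F>. F \<subseteq> F' \<longrightarrow> F = F'"
    by metis
  have F_simple: "simple_graph (?graph F)" and F_clique_free: "clique_free (Suc r) (?graph F)"
    using F_in(1) assms(1) by (auto simp: \<F>_def simple_graph_def)
  have "\<exists>A. completing_clique (?graph F) r x y A"
    if xy_nonadjacent: "x \<in> verts G" "y \<in> verts G" "x \<noteq> y" "\<not> adjacent (?graph F) x y" for x y
  proof -
    have "insert {x, y} F \<notin> \<F>"
      using F_maximal xy_nonadjacent(4) by (auto simp: adjacent_def)
    then obtain K where "is_clique (?graph (insert {x, y} F)) K" "card K = Suc r"
      using F_in(1) xy_nonadjacent(1-3) by (auto simp: \<F>_def clique_free_def)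
    then show ?thesis
      using completing_clique_if_edge_creates_clique[OF F_simple F_clique_free, of x y K] xy_nonadjacent
      by auto
  qed
  then have "clique_saturated (?graph F) r"
    using F_clique_free by (simp add: clique_saturated_def)
  then show ?thesis
    using that[of "?graph F"] F_simple F_in(2) by simp
qed

text \<open>Each vertex takes as its colour a vertex of a fixed maximal clique to which it is not adjacent.\<close>

lemma partite_if_nonadjacent_trans:
  assumes "simple_graph G" "clique_free (Suc r) G"
    and trans: "\<And>y x\<^sub>1 x\<^sub>2. y \<in> verts G \<Longrightarrow> x\<^sub>1 \<in> verts G \<Longrightarrow> x\<^sub>2 \<in> verts G \<Longrightarrow>
      \<not> adjacent G y x\<^sub>1 \<Longrightarrow> \<not> adjacent G y x\<^sub>2 \<Longrightarrow> \<not> adjacent G x\<^sub>1 x\<^sub>2"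
  shows "partite r G"
proof -
  have "{K. is_clique G K} \<subseteq> Pow (verts G)"
    by (auto simp: is_clique_def)
  then have "finite {K. is_clique G K}"
    using assms(1) finite_subset simple_graph_finite_verts by blast
  moreover have "{K. is_clique G K} \<noteq> {}"
    by (auto simp: is_clique_def intro: exI[of _ "{}"])
  ultimately obtain K where K_clique: "is_clique G K" and K_maximal: "\<forall>L. is_clique G L \<longrightarrow> K \<subseteq> L \<longrightarrow> K = L"
    using finite_has_maximal[of "{K. is_clique G K}"] by auto
  have "\<exists>k\<in>K. \<not> adjacent G k v" if "v \<in> verts G" for v
  proof (cases "v \<in> K")
    case True
    then show ?thesis using simple_graph_adjacentD(3)[OF assms(1)] by blast
  next
    case False
    then have "\<not> is_clique G (insert v K)" using K_maximal by blast
    then show ?thesis using K_clique that adjacent_commute[of G v] by (auto simp: is_clique_insert)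
  qed
  then obtain k where k_nonadjacent: "\<And>v. v \<in> verts G \<Longrightarrow> k v \<in> K \<and> \<not> adjacent G (k v) v" by metis
  have "k u \<noteq> k v" if "adjacent G u v" for u v
    using trans[of "k u" u v] k_nonadjacent K_clique that simple_graph_adjacentD[OF assms(1) that]
    by (metis is_clique_def subsetD)
  then have "proper_colouring G K k"
    using k_nonadjacent by (auto simp: proper_colouring_def)
  then show ?thesis
    using assms(1,2) K_clique
    by (intro partite_if_proper_colouring[of G K k r] is_clique_finite clique_free_card_le)
qed

lemma dense_graph_supergraph:
  assumes "dense_graph G r m" "simple_graph G'" "verts G' = verts G" "edges G \<subseteq> edges G'"
  shows "dense_graph G' r m"
proof -
  interpret dense_graph G r m by fact
  have "nonneighbours G' v \<subseteq> nonneighbours G v" for v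
    using assms(3,4) by (auto simp: nonneighbours_def adjacent_def)
  then have "card (nonneighbours G' v) \<le> card (nonneighbours G v)" for v
    using simple by (simp add: card_mono finite_nonneighbours)
  then show ?thesis
    using assms(2,3) card_nonneighbours_le few_nonneighbours
    by unfold_locales (auto intro: le_trans)
qed

theorem andrasfai_erdos_sos:
  assumes "dense_graph G r m" "clique_free (Suc r) G"
  shows "partite r G"
proof -
  interpret dense_graph G r m by fact
  obtain G' where supergraph: "simple_graph G'" "verts G' = verts G" "edges G \<subseteq> edges G'"
    "clique_saturated G' r"
    using clique_saturated_supergraph[OF simple assms(2)] .
  then have "dense_graph G' r m"
    using dense_graph_supergraph[OF assms(1)] by blast
  then have "partite r G'"
    using supergraph(1,4) nonadjacent_trans[of G' r m] clique_saturated_def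
    by (intro partite_if_nonadjacent_trans) blast+
  moreover have "graph_hom (\<lambda>v. v) G G'"
    using supergraph(2,3) by (auto simp: graph_hom_def adjacent_def)
  ultimately show ?thesis
    using partite_graph_hom by blast
qed

section \<open>Uniqueness of colourings\<close>

context dense_graph
begin

lemma pred_mult_less: "(r - 1) * m < card (verts G)"
proof -
  have "3 * (r - 1) * m \<le> (3 * r - 1) * m"
    by (rule mult_right_mono) auto
  then show ?thesis
    using few_nonneighbours unfolding mult.assoc by linarith
qed

lemma colour_class_subset_nonneighbours:
  assumes "proper_colouring G C c"
  shows "{v \<in> verts G. c v = c w} \<subseteq> nonneighbours G w"
  using proper_colouring_neq[OF assms, of w] by (force simp: nonneighbours_def)

lemma card_colour_class_le:
  assumes "proper_colouring G C c"
  shows "card {v \<in> verts G. c v = i} \<le> m"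
proof (cases "{v \<in> verts G. c v = i} = {}")
  case False
  then obtain w where w_in: "w \<in> verts G" "c w = i" by blast
  then have "card {v \<in> verts G. c v = i} \<le> card (nonneighbours G w)"
    using colour_class_subset_nonneighbours[OF assms] simple
    by (intro card_mono finite_nonneighbours) auto
  then show ?thesis using card_nonneighbours_le[OF w_in(1)] by linarith
qed (simp only: card.empty)

lemma card_verts_le_colour_classes:
  assumes "proper_colouring G C c" "finite C"
  shows "card (verts G) \<le> card {v \<in> verts G. c v \<in> I} + card (C - I) * m"
proof -
  let ?class = "\<lambda>i. {v \<in> verts G. c v = i}"
  have "verts G \<subseteq> {v \<in> verts G. c v \<in> I} \<union> (\<Union>i\<in>C - I. ?class i)"
    using proper_colouring_in[OF assms(1)] by blast
  then have "card (verts G) \<le> card ({v \<in> verts G. c v \<in> I} \<union> (\<Union>i\<in>C - I. ?class i))"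
    using assms(2) simple_graph_finite_verts[OF simple] by (intro card_mono) auto
  also have "\<dots> \<le> card {v \<in> verts G. c v \<in> I} + card (\<Union>i\<in>C - I. ?class i)"
    by (rule card_Un_le)
  also have "card (\<Union>i\<in>C - I. ?class i) \<le> (\<Sum>i\<in>C - I. card (?class i))"
    using assms(2) by (intro card_UN_le) simp
  also have "\<dots> \<le> card (C - I) * m"
    using sum_bounded_above[of "C - I" "\<lambda>i. card (?class i)" m] card_colour_class_le[OF assms(1)] by simp
  finally show ?thesis by simp
qed

lemma colour_used:
  assumes "proper_colouring G C c" "finite C" "card C = r" "i \<in> C"
  obtains v where "v \<in> verts G" "c v = i"
proof -
  have "card (C - {i}) = r - 1"
    using assms(2-4) by simp
  then have "card {v \<in> verts G. c v \<in> {i}} \<noteq> 0"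
    using card_verts_le_colour_classes[OF assms(1,2), of "{i}"] pred_mult_less by simp
  then have "{v \<in> verts G. c v \<in> {i}} \<noteq> {}"
    by (metis card.empty)
  then show ?thesis using that by blast
qed

lemma missing_colour_unique:
  assumes colouring: "proper_colouring G C c" "finite C" "card C = r"
    and few_outside: "card (verts G - N) \<le> m" and missing: "i \<in> C - c ` N" "j \<in> C - c ` N"
  shows "i = j"
proof (rule ccontr)
  assume "i \<noteq> j"
  then have card_rest: "card (C - {i, j}) = r - 2" "2 \<le> r"
    using colouring(2,3) missing card_Diff_subset[of "{i, j}" C] card_mono[of C "{i, j}"] by auto
  have "{v \<in> verts G. c v \<in> {i, j}} \<subseteq> verts G - N"
    using missing by blast
  then have "card {v \<in> verts G. c v \<in> {i, j}} \<le> card (verts G - N)"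
    using simple_graph_finite_verts[OF simple] by (intro card_mono) auto
  then have "card (verts G) \<le> m + (r - 2) * m"
    using card_verts_le_colour_classes[OF colouring(1,2), of "{i, j}"] card_rest(1) few_outside by simp
  also have "\<dots> = (r - 1) * m"
    using card_rest(2) by (simp add: Suc_diff_Suc numeral_2_eq_2 flip: mult_Suc)
  finally show False
    using pred_mult_less by simp
qed

lemma same_colour_common_neighbour:
  assumes colouring: "proper_colouring G C c" "finite C" "card C = r" and r_ge_2: "2 \<le> r"
    and same_colour: "u \<in> verts G" "v \<in> verts G" "c u = c v"
  obtains w where "w \<in> verts G" "adjacent G w u" "adjacent G w v"
proof -
  let ?N = "nonneighbours G"
  note finite = finite_nonneighbours[OF simple]
  have "card (C - {c u}) = r - 1"
    using colouring(2,3) proper_colouring_in[OF colouring(1) same_colour(1)] by simp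
  then have "card (verts G) \<le> card {z \<in> verts G. c z = c u} + (r - 1) * m"
    using card_verts_le_colour_classes[OF colouring(1,2), of "{c u}"] by simp
  moreover have "{z \<in> verts G. c z = c u} \<subseteq> ?N u \<inter> ?N v"
    using colour_class_subset_nonneighbours[OF colouring(1)] same_colour(3) by force
  then have "card {z \<in> verts G. c z = c u} \<le> card (?N u \<inter> ?N v)"
    using finite by (intro card_mono) auto
  moreover have "card (?N u \<union> ?N v) + card (?N u \<inter> ?N v) \<le> 2 * m"
    using card_Un_Int[OF finite finite, of u v] card_nonneighbours_le[OF same_colour(1)]
      card_nonneighbours_le[OF same_colour(2)] by linarith
  moreover have "r - 1 + 2 = r + 1"
    using r_ge_2 by simp
  then have "(r - 1) * m + 2 * m = (r + 1) * m"
    by (simp only: add_mult_distrib[symmetric])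
  moreover have "3 * (r + 1) * m \<le> 2 * (3 * r - 1) * m"
    using r_ge_2 by (intro mult_right_mono) auto
  ultimately have "card (?N u \<union> ?N v) < card (verts G)"
    using few_nonneighbours unfolding mult.assoc by linarith
  then have "\<not> verts G \<subseteq> ?N u \<union> ?N v"
    using card_mono[of "?N u \<union> ?N v" "verts G"] finite by auto
  then show ?thesis
    using that adjacent_commute[of G u] adjacent_commute[of G v] by (auto simp: nonneighbours_def)
qed

lemma dense_graph_neighbourhood:
  assumes r_ge_2: "2 \<le> r" and w_in: "w \<in> verts G"
  shows "dense_graph (induced_subgraph G (neighbours G w)) (r - 1) m"
proof
  let ?G' = "induced_subgraph G (neighbours G w)"
  show "simple_graph ?G'"
    using simple by (simp add: simple_pullback_graph finite_neighbours)
  show "card (nonneighbours ?G' v) \<le> m" if "v \<in> verts ?G'" for v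
  proof -
    have "nonneighbours ?G' v \<subseteq> nonneighbours G v" and v_in: "v \<in> verts G"
      using that by (auto simp: nonneighbours_def neighbours_def)
    then have "card (nonneighbours ?G' v) \<le> card (nonneighbours G v)"
      using simple by (intro card_mono finite_nonneighbours)
    then show ?thesis using card_nonneighbours_le[OF v_in] by linarith
  qed
  have "3 * (r - 1) - 1 + 3 = 3 * r - 1"
    using r_ge_2 by simp
  then have "(3 * (r - 1) - 1) * m + 3 * m = (3 * r - 1) * m"
    by (simp only: add_mult_distrib[symmetric])
  moreover have "card (verts G) \<le> card (verts ?G') + m"
    using degree_add_card_nonneighbours[OF simple, of w] card_nonneighbours_le[OF w_in]
    by (simp add: degree_eq_card_neighbours)
  ultimately show "(3 * (r - 1) - 1) * m < 3 * card (verts ?G')"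
    using few_nonneighbours by linarith
qed

end

lemma proper_colouring_neighbourhood:
  assumes "proper_colouring G C c"
  shows "proper_colouring (induced_subgraph G (neighbours G w)) (C - {c w}) c"
  using assms unfolding proper_colouring_def neighbours_def by fastforce

text \<open>Two vertices of the same colour have a common neighbour, and the hypotheses carry over to its
  neighbourhood with one colour less.\<close>

lemma dense_graph_colouring_unique:
  assumes "dense_graph G r m"
    and "proper_colouring G C c" "finite C" "card C = r" "proper_colouring G D d" "finite D" "card D = r"
    and "u \<in> verts G" "v \<in> verts G" "c u = c v"
  shows "d u = d v"
  using assms
proof (induction r arbitrary: G C D)
  case 0
  then show ?case
    using proper_colouring_in[of G D d u] by simp
next
  case (Suc r)
  note dense = \<open>dense_graph G (Suc r) m\<close>
  note colouring_c = \<open>proper_colouring G C c\<close> \<open>finite C\<close> \<open>card C = Suc r\<close>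
    and colouring_d = \<open>proper_colouring G D d\<close> \<open>finite D\<close> \<open>card D = Suc r\<close>
  note same_colour = \<open>u \<in> verts G\<close> \<open>v \<in> verts G\<close> \<open>c u = c v\<close>
  show ?case
  proof (cases "r = 0")
    case True
    then show ?thesis
      using colouring_d proper_colouring_in[OF colouring_d(1)] same_colour by (auto simp: card_Suc_eq)
  next
    case False
    then have r_ge_2: "2 \<le> Suc r" by simp
    obtain w where common_neighbour: "w \<in> verts G" "adjacent G w u" "adjacent G w v"
      using dense_graph.same_colour_common_neighbour[OF dense colouring_c r_ge_2 same_colour] .
    have "card (C - {c w}) = r" "card (D - {d w}) = r"
      using colouring_c colouring_d common_neighbour(1) by (simp_all add: proper_colouring_in)
    moreover have "dense_graph (induced_subgraph G (neighbours G w)) r m"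
      using dense_graph.dense_graph_neighbourhood[OF dense r_ge_2 common_neighbour(1)] by simp
    moreover have "u \<in> neighbours G w" "v \<in> neighbours G w"
      using same_colour common_neighbour by (simp_all add: neighbours_def)
    ultimately show ?thesis
      using colouring_c(2) colouring_d(2) same_colour(3) proper_colouring_neighbourhood[OF colouring_c(1)]
        proper_colouring_neighbourhood[OF colouring_d(1)]
      by (intro Suc.IH[of "induced_subgraph G (neighbours G w)" "C - {c w}" "D - {d w}"]) simp_all
  qed
qed

definition least_missing :: "nat set \<Rightarrow> nat" where
  "least_missing X = (LEAST i. i \<notin> X)"

lemma least_missing_notin: "i \<notin> X \<Longrightarrow> least_missing X \<notin> X"
  unfolding least_missing_def by (rule LeastI)

lemma least_missing_le: "i \<notin> X \<Longrightarrow> least_missing X \<le> i"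
  unfolding least_missing_def by (rule Least_le)

context dense_graph
begin

lemma least_missing_colour_transfer:
  assumes colouring_c: "proper_colouring G {..<r} c" and colouring_d: "proper_colouring G {..<r} d"
    and few_outside: "N \<subseteq> verts G" "card (verts G - N) \<le> m" and a_missing: "a \<in> {..<r} - d ` N"
  obtains v where "v \<in> verts G" "d v = a" "c v = least_missing (c ` N)"
proof -
  obtain v where v_colour_a: "v \<in> verts G" "d v = a"
    using colour_used[OF colouring_d] a_missing by auto
  have "c u \<noteq> c v" if "u \<in> N" for u
  proof
    assume "c u = c v"
    then have "d u = d v"
      using that few_outside(1) v_colour_a(1)
      by (intro dense_graph_colouring_unique[OF dense_graph_axioms colouring_c _ _ colouring_d]) auto
    then show False using that v_colour_a(2) a_missing by auto
  qed
  then have "c v \<in> {..<r} - c ` N"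
    using proper_colouring_in[OF colouring_c v_colour_a(1)] by force
  moreover from this have "least_missing (c ` N) \<in> {..<r} - c ` N"
    using least_missing_notin[of "c v" "c ` N"] least_missing_le[of "c v" "c ` N"] by simp
  ultimately have "c v = least_missing (c ` N)"
    using missing_colour_unique[OF colouring_c _ _ few_outside(2)] by simp
  then show ?thesis using that v_colour_a by blast
qed

lemma least_missing_colours_neq:
  assumes colouring_c: "proper_colouring G {..<r} c" and colouring_d: "proper_colouring G {..<r} d"
    and few_outside: "N \<subseteq> verts G" "card (verts G - N) \<le> m"
    and few_outside': "N' \<subseteq> verts G" "card (verts G - N') \<le> m"
    and missing: "a \<in> {..<r} - d ` N" "b \<in> {..<r} - d ` N'" "a \<noteq> b"
  shows "least_missing (c ` N) < r" "least_missing (c ` N') < r"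
    and "least_missing (c ` N) \<noteq> least_missing (c ` N')"
proof -
  obtain u where u_colour_a: "u \<in> verts G" "d u = a" "c u = least_missing (c ` N)"
    using least_missing_colour_transfer[OF colouring_c colouring_d few_outside missing(1)] .
  obtain v where v_colour_b: "v \<in> verts G" "d v = b" "c v = least_missing (c ` N')"
    using least_missing_colour_transfer[OF colouring_c colouring_d few_outside' missing(2)] .
  show "least_missing (c ` N) < r" "least_missing (c ` N') < r"
    using u_colour_a v_colour_b proper_colouring_in[OF colouring_c] by force+
  have "d u = d v" if "c u = c v"
    using that u_colour_a(1) v_colour_b(1)
    by (intro dense_graph_colouring_unique[OF dense_graph_axioms colouring_c _ _ colouring_d]) auto
  then have "c u \<noteq> c v"
    using u_colour_a(2) v_colour_b(2) missing(3) by blast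
  then show "least_missing (c ` N) \<noteq> least_missing (c ` N')"
    using u_colour_a(3) v_colour_b(3) by simp
qed

end

section \<open>Random tuples\<close>

lemma bij_betw_tuples_Suc:
  "bij_betw (\<lambda>(v, x). x(k := v)) (V \<times> ({..<k} \<rightarrow>\<^sub>E V)) ({..<Suc k} \<rightarrow>\<^sub>E V)"
  using inj_combinator[of k "{..<k}" "\<lambda>_. V"] PiE_insert_eq[of k "{..<k}" "\<lambda>_. V"]
  by (simp add: bij_betw_def lessThan_Suc)

lemma bij_betw_preimage_card:
  assumes "bij_betw f A B" "R \<subseteq> B"
  shows "card {a \<in> A. f a \<in> R} = card R"
proof (rule bij_betw_same_card)
  have "f ` {a \<in> A. f a \<in> R} = f ` A \<inter> R" by blast
  then show "bij_betw f {a \<in> A. f a \<in> R} R"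
    using assms by (intro bij_betw_subset[OF assms(1)]) (auto simp: bij_betw_def)
qed

lemma sum_tuples_Suc:
  "(\<Sum>x\<in>{..<Suc k} \<rightarrow>\<^sub>E V. f x) = (\<Sum>x\<in>{..<k} \<rightarrow>\<^sub>E V. \<Sum>v\<in>V. f (x(k := v)))"
proof -
  have "(\<Sum>x\<in>{..<Suc k} \<rightarrow>\<^sub>E V. f x) = (\<Sum>(v, x)\<in>V \<times> ({..<k} \<rightarrow>\<^sub>E V). f (x(k := v)))"
    using sum.reindex_bij_betw[OF bij_betw_tuples_Suc, of f] by (simp add: case_prod_unfold)
  also have "\<dots> = (\<Sum>x\<in>{..<k} \<rightarrow>\<^sub>E V. \<Sum>v\<in>V. f (x(k := v)))"
    unfolding sum.cartesian_product[symmetric] by (rule sum.swap)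
  finally show ?thesis .
qed

lemma sum_prod_tuples_fixed_entry:
  fixes f :: "'a \<Rightarrow> 'b :: comm_semiring_1"
  assumes "finite I" "finite V" "i \<in> I" "v \<in> V"
  shows "(\<Sum>x\<in>{x \<in> I \<rightarrow>\<^sub>E V. x i = v}. \<Prod>j\<in>I. f (x j)) = f v * (\<Sum>y\<in>V. f y) ^ (card I - 1)"
proof -
  let ?B = "\<lambda>j. if j = i then {v} else V"
  have "{x \<in> I \<rightarrow>\<^sub>E V. x i = v} = PiE I ?B"
    using assms(3,4) by (auto simp: PiE_iff extensional_def split: if_splits)
  then have "(\<Sum>x\<in>{x \<in> I \<rightarrow>\<^sub>E V. x i = v}. \<Prod>j\<in>I. f (x j)) = (\<Prod>j\<in>I. \<Sum>y\<in>?B j. f y)"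
    using assms(1,2) by (simp add: prod_sum_PiE)
  also have "\<dots> = f v * (\<Prod>j\<in>I - {i}. \<Sum>y\<in>?B j. f y)"
    using assms(1,3) by (subst prod.remove[of I i]) simp_all
  also have "(\<Prod>j\<in>I - {i}. \<Sum>y\<in>?B j. f y) = (\<Sum>y\<in>V. f y) ^ (card I - 1)"
    using assms(3) by simp
  finally show ?thesis .
qed

lemma sum_exp_if_le:
  fixes p \<beta> :: real
  assumes "finite V" "0 \<le> \<beta>" "\<beta> \<le> 1" "card {y \<in> V. P y} \<le> p * card V"
  shows "(\<Sum>y\<in>V. if P y then exp \<beta> else 1) \<le> card V * exp (p * (\<beta> + \<beta>\<^sup>2))"
proof -
  have "(\<Sum>y\<in>V. if P y then exp \<beta> else 1) = (\<Sum>y\<in>V. 1 + (if P y then exp \<beta> - 1 else 0))"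
    by (intro sum.cong) auto
  also have "\<dots> = card V + card {y \<in> V. P y} * (exp \<beta> - 1)"
    using assms(1) by (simp add: sum.distrib sum.If_cases Int_def)
  also have "\<dots> \<le> card V + (p * card V) * (\<beta> + \<beta>\<^sup>2)"
    using exp_bound[OF assms(2,3)] assms(2,4) by (intro add_left_mono mult_mono) auto
  also have "\<dots> = card V * (1 + p * (\<beta> + \<beta>\<^sup>2))"
    by (simp add: algebra_simps)
  also have "\<dots> \<le> card V * exp (p * (\<beta> + \<beta>\<^sup>2))"
    by (intro mult_left_mono exp_ge_add_one_self) auto
  finally show ?thesis .
qed

text \<open>The summand \<open>\<beta>\<close> in the exponent pays for the \<open>i\<close>-th entry, which is not independent of itself.\<close>

lemma sum_exp_card_related_entries_le:
  fixes p \<beta> :: real and N :: "'a \<Rightarrow> 'a \<Rightarrow> bool"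
  assumes finite: "finite I" "finite V" and i_in: "i \<in> I" and \<beta>_bounds: "0 \<le> \<beta>" "\<beta> \<le> 1"
    and p_nonneg: "0 \<le> p"
    and few_related: "\<And>v. v \<in> V \<Longrightarrow> card {y \<in> V. N v y} \<le> p * card V"
  shows "(\<Sum>x\<in>I \<rightarrow>\<^sub>E V. exp (\<beta> * card {j \<in> I. N (x i) (x j)}))
    \<le> exp (\<beta> + p * (\<beta> + \<beta>\<^sup>2) * card I) * card V ^ card I"
proof -
  define f where "f v y = (if N v y then exp \<beta> else 1)" for v y
  define q where "q = p * (\<beta> + \<beta>\<^sup>2)"
  have "0 \<le> q" using p_nonneg \<beta>_bounds by (simp add: q_def)
  have exp_eq: "exp (\<beta> * card {j \<in> I. N v (x j)}) = (\<Prod>j\<in>I. f v (x j))" for v x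
    using finite(1) by (simp add: f_def prod.If_cases Int_def exp_of_nat2_mult)
  have "(\<Sum>x\<in>I \<rightarrow>\<^sub>E V. exp (\<beta> * card {j \<in> I. N (x i) (x j)}))
      = (\<Sum>v\<in>V. \<Sum>x\<in>{x \<in> I \<rightarrow>\<^sub>E V. x i = v}. \<Prod>j\<in>I. f (x i) (x j))"
    unfolding exp_eq using finite i_in by (intro sum.group[symmetric] finite_PiE) auto
  also have "\<dots> = (\<Sum>v\<in>V. \<Sum>x\<in>{x \<in> I \<rightarrow>\<^sub>E V. x i = v}. \<Prod>j\<in>I. f v (x j))"
    by (intro sum.cong) auto
  also have "\<dots> = (\<Sum>v\<in>V. f v v * (\<Sum>y\<in>V. f v y) ^ (card I - 1))"
    using finite i_in by (intro sum.cong refl sum_prod_tuples_fixed_entry)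
  also have "\<dots> \<le> (\<Sum>v\<in>V. exp \<beta> * (card V * exp q) ^ (card I - 1))"
    using sum_exp_if_le[OF finite(2) \<beta>_bounds few_related] \<beta>_bounds unfolding f_def q_def
    by (intro sum_mono mult_mono power_mono sum_nonneg zero_le_power) auto
  also have "\<dots> = exp (\<beta> + q * (card I - 1)) * (card V * card V ^ (card I - 1))"
    by (simp add: power_mult_distrib exp_add exp_of_nat2_mult)
  also have "card V * card V ^ (card I - 1) = card V ^ card I"
    using finite(1) i_in by (metis card_Suc_Diff1 diff_Suc_1 power_Suc)
  also have "exp (\<beta> + q * (card I - 1)) * card V ^ card I \<le> exp (\<beta> + q * card I) * card V ^ card I"
    using \<open>0 \<le> q\<close> by (intro mult_right_mono) (auto intro: mult_left_mono)
  finally show ?thesis unfolding q_def .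
qed

lemma card_large_value_le_exp_moment:
  fixes f :: "'a \<Rightarrow> real"
  assumes "finite X" "0 \<le> \<beta>"
  shows "card {x \<in> X. \<tau> \<le> f x} \<le> (\<Sum>x\<in>X. exp (\<beta> * f x)) / exp (\<beta> * \<tau>)"
proof -
  have "card {x \<in> X. \<tau> \<le> f x} * exp (\<beta> * \<tau>) = (\<Sum>x\<in>{x \<in> X. \<tau> \<le> f x}. exp (\<beta> * \<tau>))"
    by simp
  also have "\<dots> \<le> (\<Sum>x\<in>{x \<in> X. \<tau> \<le> f x}. exp (\<beta> * f x))"
    using assms(2) by (intro sum_mono) (simp add: mult_left_mono)
  also have "\<dots> \<le> (\<Sum>x\<in>X. exp (\<beta> * f x))"
    using assms(1) by (intro sum_mono2) auto
  finally show ?thesis by (simp add: pos_le_divide_eq)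
qed

lemma card_tuples_many_related_entries_le:
  fixes p \<beta> \<tau> :: real and N :: "'a \<Rightarrow> 'a \<Rightarrow> bool"
  assumes "finite I" "finite V" "i \<in> I" "0 \<le> \<beta>" "\<beta> \<le> 1" "0 \<le> p"
    and "\<And>v. v \<in> V \<Longrightarrow> card {y \<in> V. N v y} \<le> p * card V"
  shows "card {x \<in> I \<rightarrow>\<^sub>E V. \<tau> \<le> card {j \<in> I. N (x i) (x j)}}
    \<le> exp (\<beta> + p * (\<beta> + \<beta>\<^sup>2) * card I - \<beta> * \<tau>) * card V ^ card I"
proof -
  have "card {x \<in> I \<rightarrow>\<^sub>E V. \<tau> \<le> card {j \<in> I. N (x i) (x j)}}
      \<le> (\<Sum>x\<in>I \<rightarrow>\<^sub>E V. exp (\<beta> * card {j \<in> I. N (x i) (x j)})) / exp (\<beta> * \<tau>)"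
    using assms(1,2,4) by (intro card_large_value_le_exp_moment finite_PiE) auto
  also have "\<dots> \<le> exp (\<beta> + p * (\<beta> + \<beta>\<^sup>2) * card I) * card V ^ card I / exp (\<beta> * \<tau>)"
    using sum_exp_card_related_entries_le[OF assms] by (intro divide_right_mono) auto
  finally show ?thesis by (simp add: exp_diff)
qed

section \<open>Complete partite subsets of dense relations\<close>

lemma card_eq_sum_card_Image:
  assumes "R \<subseteq> V \<times> Y" "finite V" "finite Y"
  shows "card R = (\<Sum>v\<in>V. card (R `` {v}))"
proof -
  have "R = (SIGMA v:V. R `` {v})"
    using assms(1) by blast
  moreover have "R `` {v} \<subseteq> Y" for v
    using assms(1) by blast
  ultimately show ?thesis
    using card_SigmaI[of V "\<lambda>v. R `` {v}"] assms(2,3) finite_subset by metis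
qed

lemma dense_relation_many_large_degrees:
  fixes \<gamma> :: real
  assumes R_finite: "R \<subseteq> V \<times> Y" "finite V" "finite Y" "0 < card Y" and \<gamma>_nonneg: "0 \<le> \<gamma>"
    and dense: "\<gamma> * card V * card Y \<le> card R"
  shows "\<gamma> / 2 * card V \<le> card {v \<in> V. \<gamma> / 2 * card Y \<le> card (R `` {v})}"
proof -
  let ?large = "\<lambda>v. \<gamma> / 2 * card Y \<le> card (R `` {v})"
  have "card (R `` {v}) \<le> card Y" for v
    using R_finite(1,3) by (intro card_mono) auto
  then have degree: "card (R `` {v}) \<le> (if ?large v then real (card Y) else 0) + \<gamma> / 2 * card Y" for v
    using \<gamma>_nonneg by (auto simp: add_increasing2)
  note dense
  also have "real (card R) = (\<Sum>v\<in>V. real (card (R `` {v})))"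
    using card_eq_sum_card_Image[OF R_finite(1-3)] by simp
  also have "\<dots> \<le> (\<Sum>v\<in>V. (if ?large v then real (card Y) else 0) + \<gamma> / 2 * card Y)"
    by (intro sum_mono degree)
  also have "\<dots> = card {v \<in> V. ?large v} * card Y + \<gamma> / 2 * card Y * card V"
    using R_finite(2) by (simp add: sum.distrib sum.If_cases Int_def)
  finally have "\<gamma> / 2 * card V * card Y \<le> card {v \<in> V. ?large v} * card Y"
    by (simp add: algebra_simps)
  then show ?thesis using R_finite(4) by simp
qed

lemma pigeonhole_common_neighbours:
  assumes R_finite: "R \<subseteq> W \<times> UNIV" "finite W" "finite Y"
    and t_le: "t \<le> card W" "\<And>y. y \<in> Y \<Longrightarrow> t \<le> card (R\<inverse> `` {y})"
  obtains T where "T \<subseteq> W" "card T = t" "card Y \<le> card {y \<in> Y. T \<times> {y} \<subseteq> R} * 2 ^ card W"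
proof -
  have "\<exists>T\<subseteq>R\<inverse> `` {y}. card T = t" if "y \<in> Y" for y
    using obtain_subset_with_card_n[OF t_le(2)[OF that]] by blast
  then obtain T where T_common: "\<And>y. y \<in> Y \<Longrightarrow> T y \<subseteq> R\<inverse> `` {y} \<and> card (T y) = t" by metis
  have nsets_finite: "finite (nsets W t)" "nsets W t \<noteq> {}"
    using R_finite(2) t_le(1) by (simp_all add: finite_imp_finite_nsets nsets_eq_empty_iff)
  have "T \<in> Y \<rightarrow> nsets W t"
  proof
    fix y assume "y \<in> Y"
    then have "T y \<subseteq> W" "card (T y) = t" using T_common R_finite(1) by blast+
    then show "T y \<in> nsets W t"
      using R_finite(2) finite_subset by (auto simp: nsets_def)
  qed
  then obtain S where S_frequent: "S \<in> nsets W t" "card Y \<le> card (T -` {S} \<inter> Y) * card (nsets W t)"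
    using pigeonhole_card[of T Y "nsets W t"] R_finite(3) nsets_finite by blast
  note S_frequent(2)
  also have "card (T -` {S} \<inter> Y) * card (nsets W t) \<le> card {y \<in> Y. S \<times> {y} \<subseteq> R} * card (Pow W)"
  proof (intro mult_le_mono card_mono)
    show "T -` {S} \<inter> Y \<subseteq> {y \<in> Y. S \<times> {y} \<subseteq> R}" using T_common by auto
  qed (use R_finite(2,3) in \<open>auto simp: nsets_def\<close>)
  finally have "card Y \<le> card {y \<in> Y. S \<times> {y} \<subseteq> R} * 2 ^ card W"
    using R_finite(2) by (simp add: card_Pow)
  then show ?thesis
    using that S_frequent(1) by (auto simp: nsets_def)
qed

text \<open>Only \<open>M\<close> vertices of large degree are used, so that the pigeonhole principle for their subsets costs
  no more than a constant factor.\<close>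

lemma dense_relation_common_neighbours:
  fixes R :: "('a \<times> 'b) set" and \<gamma> :: real
  assumes R_finite: "R \<subseteq> V \<times> Y" "finite V" "finite Y" "0 < card Y" and \<gamma>_pos: "0 < \<gamma>"
    and dense: "\<gamma> * card V * card Y \<le> card R"
    and M_bounds: "0 < M" "4 * real t \<le> \<gamma> * M" "t \<le> M" and large: "2 * real M \<le> \<gamma> * card V"
  obtains T where "T \<subseteq> V" "card T = t" "\<gamma> / (4 * 2 ^ M) * card Y \<le> card {y \<in> Y. T \<times> {y} \<subseteq> R}"
proof -
  let ?V' = "{v \<in> V. \<gamma> / 2 * card Y \<le> card (R `` {v})}"
  have "M \<le> card ?V'"
    using dense_relation_many_large_degrees[OF R_finite _ dense] \<gamma>_pos large by simp
  then obtain W where W_large: "W \<subseteq> ?V'" "card W = M" "finite W"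
    by (rule obtain_subset_with_card_n)
  define S where "S = R \<inter> W \<times> Y"
  have "\<gamma> / 2 * card Y * card W \<le> (\<Sum>w\<in>W. real (card (R `` {w})))"
    using sum_bounded_below[of W "\<gamma> / 2 * card Y" "\<lambda>w. real (card (R `` {w}))"] W_large(1)
    by (auto simp: mult.commute)
  also have "\<dots> = (\<Sum>w\<in>W. real (card (S `` {w})))"
    using R_finite(1) by (intro sum.cong refl) (auto simp: S_def intro!: arg_cong[where f = card])
  also have "\<dots> = card (S\<inverse>)"
    using card_eq_sum_card_Image[of S W Y] W_large(3) R_finite(3) by (simp add: S_def)
  finally have S_dense: "\<gamma> / 2 * card Y * card W \<le> card (S\<inverse>)" .
  let ?Y' = "{y \<in> Y. \<gamma> / 2 / 2 * card W \<le> card (S\<inverse> `` {y})}"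
  have card_Y': "\<gamma> / 2 / 2 * card Y \<le> card ?Y'"
    using W_large(2,3) M_bounds(1) \<gamma>_pos R_finite(3) S_dense
    by (intro dense_relation_many_large_degrees) (auto simp: S_def)
  have "t \<le> card (S\<inverse> `` {y})" if "y \<in> ?Y'" for y
    using that M_bounds(2) W_large(2) by simp
  then obtain T where T_common: "T \<subseteq> W" "card T = t" "card ?Y' \<le> card {y \<in> ?Y'. T \<times> {y} \<subseteq> S} * 2 ^ card W"
    using W_large(2,3) M_bounds(3) R_finite(3) pigeonhole_common_neighbours[of S W ?Y' t]
    by (auto simp: S_def)
  note T_common(3)
  also have "card {y \<in> ?Y'. T \<times> {y} \<subseteq> S} * 2 ^ card W \<le> card {y \<in> Y. T \<times> {y} \<subseteq> R} * 2 ^ M"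
    using R_finite(3) W_large(2) by (intro mult_le_mono card_mono) (auto simp: S_def)
  finally have "real (card ?Y') \<le> real (card {y \<in> Y. T \<times> {y} \<subseteq> R} * 2 ^ M)"
    by (rule of_nat_mono)
  then have "\<gamma> / (4 * 2 ^ M) * card Y \<le> card {y \<in> Y. T \<times> {y} \<subseteq> R}"
    using card_Y' by (simp add: field_simps)
  then show ?thesis
    using that T_common(1,2) W_large(1) by blast
qed

definition contains_box :: "(nat \<Rightarrow> 'a) set \<Rightarrow> nat \<Rightarrow> nat \<Rightarrow> 'a set \<Rightarrow> bool" where
  "contains_box R k t V \<longleftrightarrow> (\<exists>B. (\<forall>i<k. B i \<subseteq> V \<and> card (B i) = t) \<and> PiE {..<k} B \<subseteq> R)"

lemma contains_box_Suc:
  assumes "contains_box {x. \<forall>v\<in>T. x(k := v) \<in> R} k t V" "T \<subseteq> V" "card T = t"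
  shows "contains_box R (Suc k) t V"
proof -
  obtain B where box: "\<forall>i<k. B i \<subseteq> V \<and> card (B i) = t" "PiE {..<k} B \<subseteq> {x. \<forall>v\<in>T. x(k := v) \<in> R}"
    using assms(1) unfolding contains_box_def by blast
  have "PiE {..<k} (B(k := T)) = PiE {..<k} B"
    by (intro PiE_cong) simp
  then have "PiE {..<Suc k} (B(k := T)) = (\<lambda>(v, x). x(k := v)) ` (T \<times> PiE {..<k} B)"
    by (simp add: lessThan_Suc PiE_insert_eq)
  then have "PiE {..<Suc k} (B(k := T)) \<subseteq> R"
    by (auto dest!: subsetD[OF box(2)])
  moreover have "\<forall>i<Suc k. (B(k := T)) i \<subseteq> V \<and> card ((B(k := T)) i) = t"
    using box(1) assms(2,3) by (simp add: less_Suc_eq)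
  ultimately show ?thesis unfolding contains_box_def by blast
qed

lemma contains_box_mono: "contains_box R k t V \<Longrightarrow> R \<subseteq> S \<Longrightarrow> contains_box S k t V"
  unfolding contains_box_def by (meson subset_trans)

lemma dense_tuples_common_entries:
  fixes \<gamma> :: real
  assumes V_finite: "finite V" "V \<noteq> {}" and R_tuples: "R \<subseteq> {..<Suc k} \<rightarrow>\<^sub>E V" and \<gamma>_pos: "0 < \<gamma>"
    and dense: "\<gamma> * card V ^ Suc k \<le> card R"
    and M_bounds: "0 < M" "4 * real t \<le> \<gamma> * M" "t \<le> M" and large: "2 * real M \<le> \<gamma> * card V"
  obtains T where "T \<subseteq> V" "card T = t"
    "\<gamma> / (4 * 2 ^ M) * card V ^ k \<le> card {x \<in> {..<k} \<rightarrow>\<^sub>E V. \<forall>v\<in>T. x(k := v) \<in> R}"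
proof -
  let ?Y = "{..<k} \<rightarrow>\<^sub>E V"
  let ?S = "{p \<in> V \<times> ?Y. (case p of (v, x) \<Rightarrow> x(k := v)) \<in> R}"
  have tuples_finite: "finite ?Y" "card ?Y = card V ^ k" "0 < card ?Y"
    using V_finite by (auto simp: card_funcsetE finite_PiE)
  have "card ?S = card R"
    using R_tuples by (rule bij_betw_preimage_card[OF bij_betw_tuples_Suc])
  then have "\<gamma> * card V * card ?Y \<le> card ?S"
    using dense tuples_finite(2) by (simp add: mult_ac)
  then obtain T where T_common: "T \<subseteq> V" "card T = t"
    "\<gamma> / (4 * 2 ^ M) * card ?Y \<le> card {x \<in> ?Y. T \<times> {x} \<subseteq> ?S}"
    using dense_relation_common_neighbours[OF _ V_finite(1) tuples_finite(1,3) \<gamma>_pos _ M_bounds large, of ?S]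
    by blast
  have "T \<times> {x} \<subseteq> ?S \<longleftrightarrow> (\<forall>v\<in>T. x(k := v) \<in> R)" if "x \<in> ?Y" for x
    using T_common(1) that by auto
  then have "{x \<in> ?Y. T \<times> {x} \<subseteq> ?S} = {x \<in> ?Y. \<forall>v\<in>T. x(k := v) \<in> R}"
    by (intro Collect_cong conj_cong refl)
  then show ?thesis
    using that T_common tuples_finite(2) by simp
qed

text \<open>When tuples are read as edges of a \<open>k\<close>-uniform hypergraph, a box is a complete \<open>k\<close>-partite
  subhypergraph, and this is Erdos' theorem on the density of such hypergraphs.\<close>

lemma dense_tuples_contain_box:
  fixes \<gamma> :: real
  assumes "0 < \<gamma>"
  shows "\<exists>n\<^sub>0. \<forall>(V :: 'a set) R. finite V \<longrightarrow> n\<^sub>0 \<le> card V \<longrightarrow> R \<subseteq> {..<k} \<rightarrow>\<^sub>E V \<longrightarrow>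
    \<gamma> * card V ^ k \<le> card R \<longrightarrow> contains_box R k t V"
  using assms
proof (induction k arbitrary: \<gamma>)
  case 0
  have "contains_box R 0 t V" if "R \<subseteq> {..<0} \<rightarrow>\<^sub>E V" "\<gamma> \<le> card R" for R and V :: "'a set"
    using that \<open>0 < \<gamma>\<close> by (auto simp: contains_box_def subset_singleton_iff)
  then show ?case by (intro exI[of _ 0]) auto
next
  case (Suc k)
  define M where "M = Suc t + nat \<lceil>4 * real t / \<gamma>\<rceil>"
  have "4 * real t / \<gamma> \<le> M" unfolding M_def by linarith
  then have M_bounds: "0 < M" "4 * real t \<le> \<gamma> * M" "t \<le> M"
    using Suc.prems by (simp_all add: M_def field_simps)
  have "0 < \<gamma> / (4 * 2 ^ M)" using Suc.prems by simp
  from Suc.IH[OF this] obtain n\<^sub>0 where contains_box_IH: "\<And>(V :: 'a set) R. finite V \<Longrightarrow> n\<^sub>0 \<le> card V \<Longrightarrow>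
      R \<subseteq> {..<k} \<rightarrow>\<^sub>E V \<Longrightarrow> \<gamma> / (4 * 2 ^ M) * card V ^ k \<le> card R \<Longrightarrow> contains_box R k t V"
    by blast
  have "contains_box R (Suc k) t V"
    if V_large: "finite V" "n\<^sub>0 + Suc (nat \<lceil>2 * real M / \<gamma>\<rceil>) \<le> card V"
      and R_tuples: "R \<subseteq> {..<Suc k} \<rightarrow>\<^sub>E V"
      and dense: "\<gamma> * card V ^ Suc k \<le> card R" for V :: "'a set" and R
  proof -
    have "2 * real M / \<gamma> \<le> card V" using V_large(2) by linarith
    then have large: "2 * real M \<le> \<gamma> * card V"
      using Suc.prems by (simp add: field_simps)
    have "V \<noteq> {}" using V_large(2) by auto
    then obtain T where T_common: "T \<subseteq> V" "card T = t"
      "\<gamma> / (4 * 2 ^ M) * card V ^ k \<le> card {x \<in> {..<k} \<rightarrow>\<^sub>E V. \<forall>v\<in>T. x(k := v) \<in> R}"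
      using dense_tuples_common_entries[OF V_large(1) _ R_tuples Suc.prems dense M_bounds large] by blast
    then have "contains_box {x \<in> {..<k} \<rightarrow>\<^sub>E V. \<forall>v\<in>T. x(k := v) \<in> R} k t V"
      using V_large by (intro contains_box_IH) auto
    then have "contains_box {x. \<forall>v\<in>T. x(k := v) \<in> R} k t V"
      by (rule contains_box_mono) blast
    then show ?thesis using T_common(1,2) by (rule contains_box_Suc)
  qed
  then show ?case by blast
qed

section \<open>Stability above the Andrasfai--Erdos--Sos density\<close>

lemma not_graph_free_if_complete_partite:
  assumes H_colouring: "simple_graph H" "proper_colouring H J c" and G_simple: "simple_graph G"
    and parts: "\<And>i. i \<in> J \<Longrightarrow> B i \<subseteq> verts G \<and> card (verts H) \<le> card (B i)"
    and parts_adjacent: "\<And>i j a b. i \<in> J \<Longrightarrow> j \<in> J \<Longrightarrow> i \<noteq> j \<Longrightarrow> a \<in> B i \<Longrightarrow> b \<in> B j \<Longrightarrow> adjacent G a b"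
  shows "\<not> graph_free H G"
proof -
  have "\<exists>e. e ` verts H \<subseteq> B i \<and> inj_on e (verts H)" if "i \<in> J" for i
    using parts[OF that] G_simple H_colouring(1)
    by (intro card_le_inj) (auto intro: finite_subset simple_graph_finite_verts)
  then obtain e where e_inj: "\<And>i. i \<in> J \<Longrightarrow> e i ` verts H \<subseteq> B i \<and> inj_on (e i) (verts H)"
    by metis
  define f where "f h = e (c h) h" for h
  have c_in: "c h \<in> J" if "h \<in> verts H" for h
    using H_colouring(2) that by (rule proper_colouring_in)
  have f_in: "f h \<in> B (c h)" if "h \<in> verts H" for h
    using e_inj[OF c_in[OF that]] that unfolding f_def by blast
  have f_adjacent: "adjacent G (f g) (f h)" if "g \<in> verts H" "h \<in> verts H" "c g \<noteq> c h" for g h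
    using parts_adjacent c_in f_in that by blast
  have "graph_hom f H G"
    unfolding graph_hom_def
  proof (intro conjI allI impI)
    show "f ` verts H \<subseteq> verts G"
      using f_in parts c_in by blast
    show "adjacent G (f g) (f h)" if "adjacent H g h" for g h
      using f_adjacent simple_graph_adjacentD[OF H_colouring(1) that]
        proper_colouring_neq[OF H_colouring(2) that] by blast
  qed
  moreover have "inj_on f (verts H)"
  proof (rule inj_onI)
    fix g h assume same_image: "g \<in> verts H" "h \<in> verts H" "f g = f h"
    then have "c g = c h"
      using f_adjacent simple_graph_adjacentD(3)[OF G_simple] by metis
    then show "g = h"
      using e_inj[OF c_in[OF same_image(1)]] same_image unfolding f_def inj_on_def by metis
  qed
  ultimately show ?thesis
    using graph_free_iff_no_inj_hom[OF H_colouring(1)] by blast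
qed

abbreviation sample_graph :: "'a graph \<Rightarrow> nat \<Rightarrow> (nat \<Rightarrow> 'a) \<Rightarrow> nat graph" where
  "sample_graph G k x \<equiv> pullback_graph G x {..<k}"

lemma contains_box_of_cliques_imp_not_graph_free:
  assumes H_partite: "simple_graph H" "partite (card J) H" and G_simple: "simple_graph G"
    and J_subset: "J \<subseteq> {..<k}"
    and box: "contains_box {x. is_clique (sample_graph G k x) J} k (Suc (card (verts H))) (verts G)"
  shows "\<not> graph_free H G"
proof -
  obtain B where box_cliques: "\<And>i. i < k \<Longrightarrow> B i \<subseteq> verts G \<and> card (B i) = Suc (card (verts H))"
    "PiE {..<k} B \<subseteq> {x. is_clique (sample_graph G k x) J}"
    using box unfolding contains_box_def by blast
  have "PiE {..<k} B \<noteq> {}"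
    using box_cliques(1) by (fastforce simp: PiE_eq_empty_iff)
  then obtain z where z_in: "z \<in> PiE {..<k} B" by blast
  have parts_adjacent: "adjacent G a b" if ij_in: "i \<in> J" "j \<in> J" "i \<noteq> j" and ab_in: "a \<in> B i" "b \<in> B j"
    for i j a b
  proof -
    have "z(i := a, j := b) \<in> PiE (insert j (insert i {..<k})) B"
      using z_in ab_in by (intro PiE_fun_upd)
    moreover have "insert j (insert i {..<k}) = {..<k}"
      using J_subset ij_in by blast
    ultimately have "is_clique (sample_graph G k (z(i := a, j := b))) J"
      using box_cliques(2) by auto
    then show ?thesis
      using is_clique_adjacent[OF _ ij_in] ij_in(3) by fastforce
  qed
  have "finite J"
    using J_subset finite_subset by blast
  obtain c where "proper_colouring H {..<card J} c"
    using H_partite(2) by (auto simp: partite_iff_proper_colouring)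
  then obtain d where "proper_colouring H J d"
    using proper_colouring_recolour[OF H_partite(1)] \<open>finite J\<close>
    by (metis card_lessThan finite_lessThan order_refl)
  then show ?thesis
    using box_cliques(1) J_subset parts_adjacent
    by (intro not_graph_free_if_complete_partite[OF H_partite(1) _ G_simple, of J d B]) auto
qed

lemma few_clique_tuples:
  fixes H :: "'a graph" and \<gamma> :: real
  assumes H_partite: "simple_graph H" "partite q H" and \<gamma>_pos: "0 < \<gamma>"
  obtains n\<^sub>0 where "\<And>(G :: 'b graph) J. simple_graph G \<Longrightarrow> graph_free H G \<Longrightarrow> n\<^sub>0 \<le> card (verts G) \<Longrightarrow>
    J \<in> nsets {..<k} q \<Longrightarrow>
    card {x \<in> {..<k} \<rightarrow>\<^sub>E verts G. is_clique (sample_graph G k x) J} \<le> \<gamma> * card (verts G) ^ k"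
proof -
  let ?t = "Suc (card (verts H))"
  obtain n\<^sub>0 where dense_imp_box: "\<And>(V :: 'b set) R. finite V \<Longrightarrow> n\<^sub>0 \<le> card V \<Longrightarrow> R \<subseteq> {..<k} \<rightarrow>\<^sub>E V \<Longrightarrow>
      \<gamma> * card V ^ k \<le> card R \<Longrightarrow> contains_box R k ?t V"
    using dense_tuples_contain_box[OF \<gamma>_pos, of k ?t] by blast
  have "card {x \<in> {..<k} \<rightarrow>\<^sub>E verts G. is_clique (sample_graph G k x) J} \<le> \<gamma> * card (verts G) ^ k"
    if G_large: "simple_graph G" "graph_free H G" "n\<^sub>0 \<le> card (verts G)" and J_in: "J \<in> nsets {..<k} q"
    for G :: "'b graph" and J
  proof (rule ccontr)
    let ?R = "{x \<in> {..<k} \<rightarrow>\<^sub>E verts G. is_clique (sample_graph G k x) J}"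
    assume "\<not> ?thesis"
    then have "contains_box ?R k ?t (verts G)"
      using G_large(1,3) by (intro dense_imp_box simple_graph_finite_verts) auto
    then have "contains_box {x. is_clique (sample_graph G k x) J} k ?t (verts G)"
      by (rule contains_box_mono) blast
    then show False
      using contains_box_of_cliques_imp_not_graph_free[OF H_partite(1) _ G_large(1)] H_partite(2) G_large(2) J_in
      by (auto simp: nsets_def)
  qed
  then show ?thesis using that by blast
qed

subsection \<open>Good samples\<close>

text \<open>The entries with index \<open>s\<close> and \<open>s + 1\<close> are two vertices to be coloured with the help of the other
  entries; the degree condition survives their removal.\<close>

definition good_sample :: "'a graph \<Rightarrow> nat \<Rightarrow> nat \<Rightarrow> (nat \<Rightarrow> 'a) \<Rightarrow> bool" where
  "good_sample G r s x \<longleftrightarrow> clique_free (Suc r) (sample_graph G (s + 2) x) \<and>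
     (\<forall>i<s + 2. (3 * r - 1) * card (nonneighbours (sample_graph G (s + 2) x) i) < 3 * s)"

definition max_missed :: "nat \<Rightarrow> nat \<Rightarrow> nat" where
  "max_missed r s = (3 * s - 1) div (3 * r - 1)"

definition sample_neighbours :: "'a graph \<Rightarrow> nat \<Rightarrow> (nat \<Rightarrow> 'a) \<Rightarrow> 'a \<Rightarrow> nat set" where
  "sample_neighbours G s x v = {i. i < s \<and> adjacent G v (x i)}"

lemma good_sample_card_nonneighbours_le:
  assumes "good_sample G r s x" "1 \<le> r" "i < s + 2"
  shows "card (nonneighbours (sample_graph G (s + 2) x) i) \<le> max_missed r s"
proof -
  have "(3 * r - 1) * card (nonneighbours (sample_graph G (s + 2) x) i) < 3 * s"
    using assms(1,3) by (simp add: good_sample_def)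
  then show ?thesis
    using assms(2) by (simp add: max_missed_def less_eq_div_iff_mult_less_eq mult.commute)
qed

lemma good_sample_dense_graph:
  assumes simple: "simple_graph G" and good: "good_sample G r s x" and r_pos: "1 \<le> r"
    and k_bounds: "s \<le> k" "k \<le> s + 2"
  shows "dense_graph (sample_graph G k x) r (max_missed r s)"
proof
  show "simple_graph (sample_graph G k x)"
    using simple by (simp add: simple_pullback_graph)
  show "card (nonneighbours (sample_graph G k x) i) \<le> max_missed r s"
    if "i \<in> verts (sample_graph G k x)" for i
  proof -
    have "card (nonneighbours (sample_graph G k x) i) \<le> card (nonneighbours (sample_graph G (s + 2) x) i)"
      using that k_bounds(2) by (intro card_mono) (auto simp: nonneighbours_def)
    then show ?thesis
      using good_sample_card_nonneighbours_le[OF good r_pos, of i] that k_bounds(2) by simp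
  qed
  have "0 < 3 * s"
    using good by (auto simp: good_sample_def)
  moreover have "(3 * r - 1) * max_missed r s \<le> 3 * s - 1"
    unfolding max_missed_def by (rule times_div_less_eq_dividend)
  ultimately show "(3 * r - 1) * max_missed r s < 3 * card (verts (sample_graph G k x))"
    using k_bounds(1) by simp
qed

lemma good_sample_card_non_sample_neighbours_le:
  assumes "good_sample G r s (x(s := u, Suc s := v))" "1 \<le> r"
  shows "card ({..<s} - sample_neighbours G s x u) \<le> max_missed r s"
    and "card ({..<s} - sample_neighbours G s x v) \<le> max_missed r s"
proof -
  let ?S = "sample_graph G (s + 2) (x(s := u, Suc s := v))"
  have "card ({..<s} - sample_neighbours G s x u) \<le> card (nonneighbours ?S s)"
    "card ({..<s} - sample_neighbours G s x v) \<le> card (nonneighbours ?S (Suc s))"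
    by (intro card_mono; auto simp: nonneighbours_def sample_neighbours_def)+
  moreover have "card (nonneighbours ?S s) \<le> max_missed r s"
    "card (nonneighbours ?S (Suc s)) \<le> max_missed r s"
    using good_sample_card_nonneighbours_le[OF assms] by simp_all
  ultimately show "card ({..<s} - sample_neighbours G s x u) \<le> max_missed r s"
    "card ({..<s} - sample_neighbours G s x v) \<le> max_missed r s" by linarith+
qed

lemma good_sample_colouring:
  assumes simple: "simple_graph G" and good: "good_sample G r s (x(s := u, Suc s := v))"
    and r_pos: "1 \<le> r"
    and uv_adjacent: "adjacent G u v"
  obtains d a b where "proper_colouring (sample_graph G s x) {..<r} d" "a \<noteq> b"
    "a \<in> {..<r} - d ` sample_neighbours G s x u" "b \<in> {..<r} - d ` sample_neighbours G s x v"
proof -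
  let ?S = "sample_graph G (s + 2) (x(s := u, Suc s := v))"
  have "dense_graph ?S r (max_missed r s)"
    using good_sample_dense_graph[OF simple good r_pos] by simp
  then have "partite r ?S"
    using good by (intro andrasfai_erdos_sos) (simp_all add: good_sample_def)
  then obtain d where colouring: "proper_colouring ?S {..<r} d"
    by (auto simp: partite_iff_proper_colouring)
  have "graph_hom (\<lambda>i. i) (sample_graph G s x) ?S"
    by (auto simp: graph_hom_def)
  then have "proper_colouring (sample_graph G s x) {..<r} d"
    using proper_colouring_graph_hom[OF _ colouring] by blast
  moreover have "d s \<noteq> d (Suc s)"
    using uv_adjacent by (intro proper_colouring_neq[OF colouring]) simp
  moreover have "d s \<in> {..<r}" "d (Suc s) \<in> {..<r}"
    using proper_colouring_in[OF colouring] by simp_all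
  moreover have "d s \<noteq> d i" if "i \<in> sample_neighbours G s x u" for i
    using that by (intro proper_colouring_neq[OF colouring]) (simp add: sample_neighbours_def)
  moreover have "d (Suc s) \<noteq> d i" if "i \<in> sample_neighbours G s x v" for i
    using that by (intro proper_colouring_neq[OF colouring]) (simp add: sample_neighbours_def)
  ultimately show ?thesis
    using that by blast
qed

text \<open>The colouring of \<open>x\<close> is unique up to renaming, so each vertex may take the colour that a fixed
  colouring of \<open>x\<close> does not use on its neighbours.\<close>

lemma colouring_from_sample:
  assumes simple: "simple_graph G" and r_pos: "1 \<le> r"
  obtains c where "\<And>v. c v < r"
    "\<And>u v. adjacent G u v \<Longrightarrow> good_sample G r s (x(s := u, Suc s := v)) \<Longrightarrow> c u \<noteq> c v"
proof -
  define \<phi> where "\<phi> = (SOME \<phi>. proper_colouring (sample_graph G s x) {..<r} \<phi>)"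
  let ?colour = "\<lambda>v. least_missing (\<phi> ` sample_neighbours G s x v)"
  have colour: "?colour u < r" "?colour v < r" "?colour u \<noteq> ?colour v"
    if uv_adjacent: "adjacent G u v" and good: "good_sample G r s (x(s := u, Suc s := v))" for u v
  proof -
    obtain d a b where colouring_d: "proper_colouring (sample_graph G s x) {..<r} d" and missing: "a \<noteq> b"
      "a \<in> {..<r} - d ` sample_neighbours G s x u" "b \<in> {..<r} - d ` sample_neighbours G s x v"
      using good_sample_colouring[OF simple good r_pos uv_adjacent] .
    have colouring_\<phi>: "proper_colouring (sample_graph G s x) {..<r} \<phi>"
      using someI[of "proper_colouring (sample_graph G s x) {..<r}", OF colouring_d] by (simp only: \<phi>_def)
    have "sample_graph G s (x(s := u, Suc s := v)) = sample_graph G s x"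
      by (intro pullback_graph_cong) auto
    then have dense: "dense_graph (sample_graph G s x) r (max_missed r s)"
      using good_sample_dense_graph[OF simple good r_pos, of s] by simp
    have "sample_neighbours G s x w \<subseteq> verts (sample_graph G s x)" for w
      by (auto simp: sample_neighbours_def)
    then show "?colour u < r" "?colour v < r" "?colour u \<noteq> ?colour v"
      using dense_graph.least_missing_colours_neq[OF dense colouring_\<phi> colouring_d _ _ _ _ missing(2,3,1)]
        good_sample_card_non_sample_neighbours_le[OF good r_pos] by simp_all
  qed
  show ?thesis
    using that[of "\<lambda>v. ?colour v mod r"] colour r_pos by simp
qed

lemma partite_after_deleting_if_few_bad_pairs:
  fixes m :: real
  assumes simple: "simple_graph G" and r_pos: "1 \<le> r"
    and few: "card {(u, v). u \<in> verts G \<and> v \<in> verts G \<and> \<not> good_sample G r s (x(s := u, Suc s := v))} \<le> m"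
  shows "partite_after_deleting r m G"
proof -
  let ?P = "{(u, v). u \<in> verts G \<and> v \<in> verts G \<and> \<not> good_sample G r s (x(s := u, Suc s := v))}"
  define D where "D = {e \<in> edges G. \<exists>u v. e = {u, v} \<and> \<not> good_sample G r s (x(s := u, Suc s := v))}"
  obtain c where colouring: "\<And>v. c v < r"
    "\<And>u v. adjacent G u v \<Longrightarrow> good_sample G r s (x(s := u, Suc s := v)) \<Longrightarrow> c u \<noteq> c v"
    using colouring_from_sample[OF simple r_pos] by blast
  have "finite ?P"
    by (rule finite_subset[of _ "verts G \<times> verts G"]) (use simple_graph_finite_verts[OF simple] in auto)
  moreover have "D \<subseteq> (\<lambda>(u, v). {u, v}) ` ?P"
  proof
    fix e assume "e \<in> D"
    then obtain u v where "e = {u, v}" "adjacent G u v" "\<not> good_sample G r s (x(s := u, Suc s := v))"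
      by (auto simp: D_def adjacent_def)
    then show "e \<in> (\<lambda>(u, v). {u, v}) ` ?P"
      using simple_graph_adjacentD(1,2)[OF simple, of u v] by (intro image_eqI[of _ _ "(u, v)"]) auto
  qed
  ultimately have "card D \<le> card ?P"
    by (rule surj_card_le)
  then have "card D \<le> m"
    using few by linarith
  moreover have "proper_colouring (G\<lparr>edges := edges G - D\<rparr>) {..<r} c"
    using colouring by (auto simp: proper_colouring_def D_def adjacent_def)
  moreover have "D \<subseteq> edges G"
    by (auto simp: D_def)
  ultimately show ?thesis
    unfolding partite_after_deleting_def partite_iff_proper_colouring by blast
qed

subsection \<open>Most samples are good\<close>

lemma card_tuples_large_sample_nonneighbourhood_le:
  fixes \<epsilon> w :: real
  assumes simple: "simple_graph G" and \<epsilon>_bounds: "0 < \<epsilon>" "2 * \<epsilon> \<le> w" and w_le_1: "w \<le> 1"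
    and few_nonneighbours: "\<And>v. v \<in> verts G \<Longrightarrow> card (nonneighbours G v) \<le> (w - 2 * \<epsilon>) * card (verts G)"
    and i_less: "i < s + 2"
  shows "card {x \<in> {..<s + 2} \<rightarrow>\<^sub>E verts G. w * s \<le> card (nonneighbours (sample_graph G (s + 2) x) i)}
    \<le> exp (3 - \<epsilon>\<^sup>2 * real (s + 2)) * card (verts G) ^ (s + 2)"
proof -
  have "nonneighbours (sample_graph G (s + 2) x) i = {j \<in> {..<s + 2}. \<not> adjacent G (x i) (x j)}" for x
    using i_less by (auto simp: nonneighbours_def)
  then have "card {x \<in> {..<s + 2} \<rightarrow>\<^sub>E verts G. w * s \<le> card (nonneighbours (sample_graph G (s + 2) x) i)}
      \<le> exp (\<epsilon> + (w - 2 * \<epsilon>) * (\<epsilon> + \<epsilon>\<^sup>2) * card {..<s + 2} - \<epsilon> * (w * s)) * card (verts G) ^ card {..<s + 2}"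
    using simple \<epsilon>_bounds w_le_1 few_nonneighbours i_less
      card_tuples_many_related_entries_le[of "{..<s + 2}" "verts G" i \<epsilon> "w - 2 * \<epsilon>"
        "\<lambda>u v. \<not> adjacent G u v" "w * s"]
    by (simp add: nonneighbours_def simple_graph_finite_verts)
  also have "\<dots> \<le> exp (3 - \<epsilon>\<^sup>2 * real (s + 2)) * card (verts G) ^ (s + 2)"
  proof -
    have "\<epsilon> + (w - 2 * \<epsilon>) * (\<epsilon> + \<epsilon>\<^sup>2) * (s + 2) - \<epsilon> * (w * s)
        = \<epsilon> + 2 * (w * \<epsilon>) - ((2 - w) * \<epsilon>\<^sup>2 + 2 * \<epsilon> ^ 3) * (s + 2)"
      by (simp add: algebra_simps power2_eq_square power3_eq_cube)
    also have "\<dots> \<le> 1 + 2 * (1 * 1) - (1 * \<epsilon>\<^sup>2 + 0) * real (s + 2)"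
      using \<epsilon>_bounds w_le_1 by (intro add_mono diff_mono mult_left_mono mult_right_mono mult_mono) auto
    finally have "\<epsilon> + (w - 2 * \<epsilon>) * (\<epsilon> + \<epsilon>\<^sup>2) * (s + 2) - \<epsilon> * (w * s) \<le> 3 - \<epsilon>\<^sup>2 * real (s + 2)"
      by simp
    then show ?thesis
      unfolding card_lessThan by (intro mult_right_mono) auto
  qed
  finally show ?thesis .
qed

lemma exists_sample_size:
  fixes a \<eta> :: real
  assumes "0 < a" "0 < \<eta>"
  obtains s :: nat where "real (s + 2) * exp (3 - a * real (s + 2)) \<le> \<eta>"
proof -
  have "(\<lambda>n. exp 3 * (real n * exp (- a) ^ n)) \<longlonglongrightarrow> exp 3 * 0"
    using assms(1) by (intro tendsto_mult tendsto_const powser_times_n_limit_0) simp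
  then have "\<forall>\<^sub>F n in sequentially. exp 3 * (real n * exp (- a) ^ n) < \<eta>"
    using assms(2) by (simp add: order_tendsto_iff)
  then obtain N where N_large: "\<And>n. n \<ge> N \<Longrightarrow> exp 3 * (real n * exp (- a) ^ n) < \<eta>"
    by (auto simp: eventually_sequentially)
  have "exp 3 * (real (N + 2) * exp (- a) ^ (N + 2)) \<le> \<eta>"
    by (intro less_imp_le N_large) simp
  also have "exp 3 * (real (N + 2) * exp (- a) ^ (N + 2)) = real (N + 2) * exp (3 - a * real (N + 2))"
    unfolding exp_of_nat2_mult[symmetric] by (simp add: exp_diff exp_minus divide_inverse)
  finally show ?thesis by (rule that)
qed

lemma bad_sample_cases:
  assumes "\<not> good_sample G r s x" "1 \<le> r"
  obtains (sparse) i where "i < s + 2"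
      "3 / (3 * real r - 1) * s \<le> card (nonneighbours (sample_graph G (s + 2) x) i)"
    | (clique) J where "J \<in> nsets {..<s + 2} (Suc r)" "is_clique (sample_graph G (s + 2) x) J"
proof (cases "clique_free (Suc r) (sample_graph G (s + 2) x)")
  case True
  then obtain i where i_sparse: "i < s + 2"
    "3 * s \<le> (3 * r - 1) * card (nonneighbours (sample_graph G (s + 2) x) i)"
    using assms(1) by (auto simp: good_sample_def not_less)
  from i_sparse(2)
  have "real (3 * s) \<le> real ((3 * r - 1) * card (nonneighbours (sample_graph G (s + 2) x) i))"
    by (simp only: of_nat_le_iff)
  then show ?thesis
    using assms(2) i_sparse(1) by (intro sparse) (simp_all add: divide_le_eq mult.commute)
next
  case False
  then obtain J where "is_clique (sample_graph G (s + 2) x) J" "card J = Suc r"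
    by (auto simp: clique_free_def)
  then show ?thesis
    by (intro clique[of J]) (auto simp: is_clique_def nsets_def card_ge_0_finite)
qed

lemma card_bad_samples_le:
  fixes b c :: real
  assumes V_finite: "finite (verts G)" and r_pos: "1 \<le> r"
    and sparse: "\<And>i. i < s + 2 \<Longrightarrow> card {x \<in> {..<s + 2} \<rightarrow>\<^sub>E verts G.
      3 / (3 * real r - 1) * s \<le> card (nonneighbours (sample_graph G (s + 2) x) i)} \<le> b"
    and cliques: "\<And>J. J \<in> nsets {..<s + 2} (Suc r) \<Longrightarrow>
      card {x \<in> {..<s + 2} \<rightarrow>\<^sub>E verts G. is_clique (sample_graph G (s + 2) x) J} \<le> c" and c_nonneg: "0 \<le> c"
  shows "card {x \<in> {..<s + 2} \<rightarrow>\<^sub>E verts G. \<not> good_sample G r s x} \<le> real (s + 2) * b + 2 ^ (s + 2) * c"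
proof -
  let ?X = "{..<s + 2} \<rightarrow>\<^sub>E verts G" and ?\<J> = "nsets {..<s + 2} (Suc r)"
  define D where "D i =
    {x \<in> ?X. 3 / (3 * real r - 1) * s \<le> card (nonneighbours (sample_graph G (s + 2) x) i)}"
    for i
  define K where "K J = {x \<in> ?X. is_clique (sample_graph G (s + 2) x) J}" for J
  have finite: "finite ?X" "finite ?\<J>"
    using V_finite by (simp_all add: finite_PiE finite_imp_finite_nsets)
  have "x \<in> (\<Union>i<s + 2. D i) \<union> (\<Union>J\<in>?\<J>. K J)" if "x \<in> ?X" "\<not> good_sample G r s x" for x
    using that(2) r_pos by (cases rule: bad_sample_cases) (use that(1) in \<open>auto simp: D_def K_def\<close>)
  then have "{x \<in> ?X. \<not> good_sample G r s x} \<subseteq> (\<Union>i<s + 2. D i) \<union> (\<Union>J\<in>?\<J>. K J)"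
    by blast
  then have "card {x \<in> ?X. \<not> good_sample G r s x} \<le> card ((\<Union>i<s + 2. D i) \<union> (\<Union>J\<in>?\<J>. K J))"
    using finite by (intro card_mono) (auto simp: D_def K_def)
  also have "\<dots> \<le> (\<Sum>i<s + 2. card (D i)) + (\<Sum>J\<in>?\<J>. card (K J))"
    using card_UN_le[of "{..<s + 2}" D] card_UN_le[OF finite(2), of K]
    by (intro order_trans[OF card_Un_le] add_mono) auto
  finally have "real (card {x \<in> ?X. \<not> good_sample G r s x})
      \<le> (\<Sum>i<s + 2. card (D i)) + (\<Sum>J\<in>?\<J>. card (K J))"
    by (simp only: of_nat_le_iff flip: of_nat_add)
  also have "\<dots> \<le> real (s + 2) * b + card ?\<J> * c"
    using sum_bounded_above[of "{..<s + 2}" "\<lambda>i. real (card (D i))" b]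
      sum_bounded_above[of ?\<J> "\<lambda>J. real (card (K J))" c] sparse cliques
    by (simp add: D_def K_def add_mono)
  also have "real (s + 2) * b + card ?\<J> * c \<le> real (s + 2) * b + 2 ^ (s + 2) * c"
  proof (rule add_left_mono[OF mult_right_mono[OF _ c_nonneg]])
    have "card ?\<J> \<le> card (Pow {..<s + 2})"
      by (intro card_mono) (auto simp: nsets_def)
    then have "real (card ?\<J>) \<le> real (2 ^ (s + 2))"
      by (simp only: of_nat_le_iff card_Pow finite_lessThan card_lessThan)
    then show "real (card ?\<J>) \<le> 2 ^ (s + 2)" by simp
  qed
  finally show ?thesis .
qed

lemma few_bad_samples:
  fixes H :: "'a graph" and c \<eta> :: real
  assumes H_partite: "simple_graph H" "partite (Suc r) H" and r_ge_2: "2 \<le> r"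
    and c_large: "1 - 1 / (real r - 1 / 3) < c" and \<eta>_pos: "0 < \<eta>"
  obtains s n\<^sub>0 where "\<And>G :: 'b graph. simple_graph G \<Longrightarrow> graph_free H G \<Longrightarrow> n\<^sub>0 \<le> card (verts G) \<Longrightarrow>
    (\<And>v. v \<in> verts G \<Longrightarrow> card (nonneighbours G v) \<le> (1 - c) * card (verts G)) \<Longrightarrow>
    card {x \<in> {..<s + 2} \<rightarrow>\<^sub>E verts G. \<not> good_sample G r s x} \<le> \<eta> * card (verts G) ^ (s + 2)"
proof -
  define w where "w = 3 / (3 * real r - 1)"
  have w_bounds: "1 / (real r - 1 / 3) = w" "0 < w" "w \<le> 1"
    using r_ge_2 by (auto simp: w_def field_simps)
  define \<epsilon> where "\<epsilon> = min ((c - (1 - w)) / 2) (w / 2)"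
  have \<epsilon>_bounds: "0 < \<epsilon>" "2 * \<epsilon> \<le> w" "1 - c \<le> w - 2 * \<epsilon>"
    using c_large w_bounds by (auto simp: \<epsilon>_def min_def field_simps)
  obtain s :: nat where sample_size: "real (s + 2) * exp (3 - \<epsilon>\<^sup>2 * real (s + 2)) \<le> \<eta> / 2"
    using exists_sample_size[of "\<epsilon>\<^sup>2" "\<eta> / 2"] \<epsilon>_bounds(1) \<eta>_pos by auto
  define \<gamma> where "\<gamma> = \<eta> / (2 * 2 ^ (s + 2))"
  have "0 < \<gamma>" using \<eta>_pos by (simp add: \<gamma>_def)
  from few_clique_tuples[OF H_partite this, of "s + 2"] obtain n\<^sub>0 where few_cliques:
    "\<And>(G :: 'b graph) J. simple_graph G \<Longrightarrow> graph_free H G \<Longrightarrow> n\<^sub>0 \<le> card (verts G) \<Longrightarrow>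
      J \<in> nsets {..<s + 2} (Suc r) \<Longrightarrow>
      card {x \<in> {..<s + 2} \<rightarrow>\<^sub>E verts G. is_clique (sample_graph G (s + 2) x) J}
        \<le> \<gamma> * card (verts G) ^ (s + 2)"
    by blast
  show ?thesis
  proof (rule that)
    fix G :: "'b graph"
    assume G_large: "simple_graph G" "graph_free H G" "n\<^sub>0 \<le> card (verts G)"
      and few_nonneighbours: "\<And>v. v \<in> verts G \<Longrightarrow> card (nonneighbours G v) \<le> (1 - c) * card (verts G)"
    let ?N = "card (verts G) ^ (s + 2)"
    have "card (nonneighbours G v) \<le> (w - 2 * \<epsilon>) * card (verts G)" if "v \<in> verts G" for v
      using few_nonneighbours[OF that] mult_right_mono[OF \<epsilon>_bounds(3), of "card (verts G)"] by linarith
    then have "card {x \<in> {..<s + 2} \<rightarrow>\<^sub>E verts G. w * s \<le> card (nonneighbours (sample_graph G (s + 2) x) i)}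
        \<le> exp (3 - \<epsilon>\<^sup>2 * real (s + 2)) * ?N" if "i < s + 2" for i
      using card_tuples_large_sample_nonneighbourhood_le[OF G_large(1) \<epsilon>_bounds(1,2) w_bounds(3) _ that]
      by blast
    then have "card {x \<in> {..<s + 2} \<rightarrow>\<^sub>E verts G. \<not> good_sample G r s x}
        \<le> real (s + 2) * (exp (3 - \<epsilon>\<^sup>2 * real (s + 2)) * ?N) + 2 ^ (s + 2) * (\<gamma> * ?N)"
      using few_cliques[OF G_large] r_ge_2 \<open>0 < \<gamma>\<close> simple_graph_finite_verts[OF G_large(1)]
      unfolding w_def
      by (intro card_bad_samples_le) auto
    also have "\<dots> \<le> \<eta> / 2 * ?N + \<eta> / 2 * ?N"
      using mult_right_mono[OF sample_size, of ?N] by (simp add: \<gamma>_def mult.assoc)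
    finally show "card {x \<in> {..<s + 2} \<rightarrow>\<^sub>E verts G. \<not> good_sample G r s x} \<le> \<eta> * ?N"
      by simp
  qed
qed

lemma exists_tuple_few_bad_pairs:
  fixes \<eta> :: real
  assumes V_finite: "finite V" "V \<noteq> {}"
    and few: "card {x \<in> {..<s + 2} \<rightarrow>\<^sub>E V. P x} \<le> \<eta> * card V ^ (s + 2)"
  obtains x where "card {(u, v). u \<in> V \<and> v \<in> V \<and> P (x(s := u, Suc s := v))} \<le> \<eta> * (card V)\<^sup>2"
proof -
  let ?X = "{..<s} \<rightarrow>\<^sub>E V"
  let ?bad = "\<lambda>x. {(u, v). u \<in> V \<and> v \<in> V \<and> P (x(s := u, Suc s := v))}"
  have card_bad: "card (?bad x) = (\<Sum>u\<in>V. \<Sum>v\<in>V. if P (x(s := u, Suc s := v)) then 1 else 0)" for x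
  proof -
    have "?bad x = (SIGMA u:V. {v \<in> V. P (x(s := u, Suc s := v))})" by auto
    then show ?thesis using V_finite(1) by (simp add: sum.If_cases Int_def)
  qed
  have tuples_finite: "finite ?X" "card ?X = card V ^ s" "?X \<noteq> {}"
    using V_finite by (auto simp: finite_PiE card_funcsetE PiE_eq_empty_iff)
  have "card {x \<in> {..<s + 2} \<rightarrow>\<^sub>E V. P x} = (\<Sum>x\<in>{..<Suc (Suc s)} \<rightarrow>\<^sub>E V. if P x then 1 else 0)"
    using V_finite(1) by (simp add: finite_PiE sum.If_cases Int_def)
  then have total: "card {x \<in> {..<s + 2} \<rightarrow>\<^sub>E V. P x} = (\<Sum>x\<in>?X. card (?bad x))"
    by (simp add: sum_tuples_Suc card_bad)
  have "\<exists>x\<in>?X. card (?bad x) \<le> \<eta> * (card V)\<^sup>2"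
  proof (rule ccontr)
    assume "\<not> ?thesis"
    then have "(\<Sum>x\<in>?X. \<eta> * (card V)\<^sup>2) < (\<Sum>x\<in>?X. real (card (?bad x)))"
      using tuples_finite by (intro sum_strict_mono) auto
    then have "\<eta> * card V ^ (s + 2) < card {x \<in> {..<s + 2} \<rightarrow>\<^sub>E V. P x}"
      unfolding total by (simp add: tuples_finite(2) power2_eq_square mult_ac)
    then show False using few by simp
  qed
  then show ?thesis using that by blast
qed

theorem minimum_degree_stability:
  fixes H :: "'a graph" and c \<eta> :: real
  assumes H_partite: "simple_graph H" "partite (Suc r) H" and r_ge_2: "2 \<le> r"
    and c_large: "1 - 1 / (real r - 1 / 3) < c" and \<eta>_pos: "0 < \<eta>"
  shows "\<exists>n\<^sub>0. \<forall>G :: 'b graph. simple_graph G \<longrightarrow> graph_free H G \<longrightarrow> n\<^sub>0 \<le> card (verts G) \<longrightarrow>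
    c * card (verts G) \<le> min_degree G \<longrightarrow> partite_after_deleting r (\<eta> * (card (verts G))\<^sup>2) G"
proof -
  obtain s n\<^sub>0 where few_bad: "\<And>G :: 'b graph. simple_graph G \<Longrightarrow> graph_free H G \<Longrightarrow> n\<^sub>0 \<le> card (verts G) \<Longrightarrow>
      (\<And>v. v \<in> verts G \<Longrightarrow> card (nonneighbours G v) \<le> (1 - c) * card (verts G)) \<Longrightarrow>
      card {x \<in> {..<s + 2} \<rightarrow>\<^sub>E verts G. \<not> good_sample G r s x} \<le> \<eta> * card (verts G) ^ (s + 2)"
    using few_bad_samples[OF H_partite r_ge_2 c_large \<eta>_pos] by blast
  have "partite_after_deleting r (\<eta> * (card (verts G))\<^sup>2) G"
    if G_large: "simple_graph G" "graph_free H G" "Suc n\<^sub>0 \<le> card (verts G)"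
      and degree: "c * card (verts G) \<le> min_degree G" for G :: "'b graph"
  proof -
    have V_finite: "finite (verts G)" "verts G \<noteq> {}"
      using G_large(1,3) simple_graph_finite_verts by auto
    have "card (nonneighbours G v) \<le> (1 - c) * card (verts G)" if "v \<in> verts G" for v
    proof -
      have "card (nonneighbours G v) + min_degree G \<le> card (verts G)"
        using min_degree_le_degree[OF G_large(1) that]
          degree_add_card_nonneighbours[OF G_large(1), of v] by simp
      then have "real (card (nonneighbours G v)) + real (min_degree G) \<le> real (card (verts G))"
        by (simp only: of_nat_le_iff flip: of_nat_add)
      then show ?thesis using degree by (simp add: algebra_simps)
    qed
    then have "card {x \<in> {..<s + 2} \<rightarrow>\<^sub>E verts G. \<not> good_sample G r s x} \<le> \<eta> * card (verts G) ^ (s + 2)"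
      using G_large by (intro few_bad) auto
    then obtain x where
      "card {(u, v). u \<in> verts G \<and> v \<in> verts G \<and> \<not> good_sample G r s (x(s := u, Suc s := v))}
        \<le> \<eta> * (card (verts G))\<^sup>2"
      using exists_tuple_few_bad_pairs[OF V_finite, of s "\<lambda>x. \<not> good_sample G r s x"] by blast
    then show ?thesis
      using G_large(1) r_ge_2 by (intro partite_after_deleting_if_few_bad_pairs) auto
  qed
  then show ?thesis by blast
qed

section \<open>Generalized wheels\<close>

lemma verts_graph_join [simp]: "verts (graph_join G F) = verts G <+> verts F"
  and verts_complete_graph [simp]: "verts (complete_graph k) = {..<k}"
  and verts_cycle_graph [simp]: "verts (cycle_graph m) = {..<m}"
  by (simp_all add: graph_join_def complete_graph_def cycle_graph_def)

lemma adjacent_graph_join [simp]: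
  "adjacent (graph_join G F) (Inl u) (Inl u') \<longleftrightarrow> adjacent G u u'"
  "adjacent (graph_join G F) (Inr v) (Inr v') \<longleftrightarrow> adjacent F v v'"
  "adjacent (graph_join G F) (Inl u) (Inr v) \<longleftrightarrow> u \<in> verts G \<and> v \<in> verts F"
  "adjacent (graph_join G F) (Inr v) (Inl u) \<longleftrightarrow> u \<in> verts G \<and> v \<in> verts F"
proof -
  have "Inl ` {u, u'} \<in> image Inl ` edges G \<longleftrightarrow> {u, u'} \<in> edges G"
    "Inr ` {v, v'} \<in> image Inr ` edges F \<longleftrightarrow> {v, v'} \<in> edges F"
    by (intro inj_image_mem_iff; simp add: inj_def inj_image_eq_iff)+
  moreover have "Inl ` {u, u'} \<notin> image Inr ` edges F" "Inr ` {v, v'} \<notin> image Inl ` edges G"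
    by (auto simp: set_eq_iff image_iff)
  ultimately show "adjacent (graph_join G F) (Inl u) (Inl u') \<longleftrightarrow> adjacent G u u'"
    "adjacent (graph_join G F) (Inr v) (Inr v') \<longleftrightarrow> adjacent F v v'"
    by (simp_all add: adjacent_def graph_join_def doubleton_eq_iff)
  show "adjacent (graph_join G F) (Inl u) (Inr v) \<longleftrightarrow> u \<in> verts G \<and> v \<in> verts F"
    "adjacent (graph_join G F) (Inr v) (Inl u) \<longleftrightarrow> u \<in> verts G \<and> v \<in> verts F"
    by (auto simp: adjacent_def graph_join_def doubleton_eq_iff)
qed

lemma adjacent_complete_graph [simp]: "adjacent (complete_graph k) i j \<longleftrightarrow> i < k \<and> j < k \<and> i \<noteq> j"
  by (auto simp: adjacent_def complete_graph_def)

lemma adjacent_cycle_graph: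
  "adjacent (cycle_graph m) i j \<longleftrightarrow> i < m \<and> j = (i + 1) mod m \<or> j < m \<and> i = (j + 1) mod m"
  by (auto simp: adjacent_def cycle_graph_def doubleton_eq_iff)

lemma simple_complete_graph: "simple_graph (complete_graph k)"
  by (simp add: simple_graph_def complete_graph_def)

lemma simple_cycle_graph:
  assumes "3 \<le> m"
  shows "simple_graph (cycle_graph m)"
proof -
  have "(i + 1) mod m < m \<and> i \<noteq> (i + 1) mod m" if "i < m" for i
    using that assms by (cases "i + 1 = m") auto
  then show ?thesis
    by (auto simp: simple_graph_def cycle_graph_def)
qed

lemma simple_graph_join:
  assumes "simple_graph G" "simple_graph F"
  shows "simple_graph (graph_join G F)"
proof -
  have "e \<in> nsets (verts G <+> verts F) 2" if edge: "e \<in> edges (graph_join G F)" for e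
  proof -
    consider (left) e' where "e' \<in> edges G" "e = Inl ` e'"
      | (right) e' where "e' \<in> edges F" "e = Inr ` e'"
      | (across) u v where "u \<in> verts G" "v \<in> verts F" "e = {Inl u, Inr v}"
      using edge unfolding graph_join_def by auto
    then show ?thesis
    proof cases
      case left
      obtain u v where "e' = {u, v}" "adjacent G u v"
        using simple_graph_edgeE[OF assms(1) left(1)] .
      then show ?thesis
        using left(2) simple_graph_adjacentD[OF assms(1)] by (simp add: InlI)
    next
      case right
      obtain u v where "e' = {u, v}" "adjacent F u v"
        using simple_graph_edgeE[OF assms(2) right(1)] .
      then show ?thesis
        using right(2) simple_graph_adjacentD[OF assms(2)] by (simp add: InrI)
    qed (simp add: InlI InrI)
  qed
  then show ?thesis
    using assms by (auto simp: simple_graph_def)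
qed

abbreviation (input) generalized_wheel :: "nat \<Rightarrow> nat \<Rightarrow> (nat + nat) graph" where
  "generalized_wheel k m \<equiv> graph_join (complete_graph k) (cycle_graph m)"

lemma simple_generalized_wheel: "3 \<le> m \<Longrightarrow> simple_graph (generalized_wheel k m)"
  by (simp add: simple_graph_join simple_complete_graph simple_cycle_graph)

subsection \<open>Colourings of generalized wheels\<close>

lemma partite_if_partite_join_complete:
  assumes simple: "simple_graph F" and "partite (k + q) (graph_join (complete_graph k) F)"
  shows "partite q F"
proof -
  let ?J = "graph_join (complete_graph k) F"
  obtain c where colouring: "proper_colouring ?J {..<k + q} c"
    using assms(2) by (auto simp: partite_iff_proper_colouring)
  define A where "A = (\<lambda>i. c (Inl i)) ` {..<k}"
  have "inj_on (\<lambda>i. c (Inl i)) {..<k}"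
  proof (rule inj_onI, rule ccontr)
    fix i j assume "i \<in> {..<k}" "j \<in> {..<k}" "c (Inl i) = c (Inl j)" "i \<noteq> j"
    then show False
      using proper_colouring_neq[OF colouring, of "Inl i" "Inl j"] by simp
  qed
  then have "card A = k"
    unfolding A_def by (simp add: card_image)
  moreover have "A \<subseteq> {..<k + q}"
    using proper_colouring_in[OF colouring] by (auto simp: A_def)
  ultimately have "card ({..<k + q} - A) = q"
    by (simp add: card_Diff_subset finite_subset)
  moreover have "proper_colouring F ({..<k + q} - A) (\<lambda>v. c (Inr v))"
    unfolding proper_colouring_def
  proof (intro conjI allI impI image_subsetI DiffI)
    fix v assume v_in: "v \<in> verts F"
    then show "c (Inr v) \<in> {..<k + q}"
      using proper_colouring_in[OF colouring, of "Inr v"] by (simp add: InrI)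
    have "c (Inr v) \<noteq> c (Inl i)" if "i < k" for i
      using proper_colouring_neq[OF colouring, of "Inr v" "Inl i"] v_in that by simp
    then show "c (Inr v) \<notin> A"
      by (auto simp: A_def)
  next
    show "c (Inr u) \<noteq> c (Inr v)" if "adjacent F u v" for u v
      using proper_colouring_neq[OF colouring, of "Inr u" "Inr v"] that by simp
  qed
  ultimately show ?thesis
    using simple by (intro partite_if_proper_colouring) auto
qed

lemma partite_join_complete:
  assumes "partite q F"
  shows "partite (k + q) (graph_join (complete_graph k) F)"
proof -
  obtain c where colouring: "proper_colouring F {..<q} c"
    using assms by (auto simp: partite_iff_proper_colouring)
  have c_less: "c v < q" if "v \<in> verts F" for v
    using proper_colouring_in[OF colouring that] by simp
  define d where "d = case_sum (\<lambda>i. q + i) c"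
  have "proper_colouring (graph_join (complete_graph k) F) {..<k + q} d"
    unfolding proper_colouring_def
  proof (intro conjI allI impI image_subsetI)
    show "d v \<in> {..<k + q}" if "v \<in> verts (graph_join (complete_graph k) F)" for v
      using that by (auto simp: d_def dest: c_less)
    show "d u \<noteq> d v" if "adjacent (graph_join (complete_graph k) F) u v" for u v
      using that by (cases u; cases v) (auto simp: d_def dest: c_less proper_colouring_neq[OF colouring])
  qed
  then show ?thesis
    by (auto simp: partite_iff_proper_colouring)
qed

lemma odd_cycle_not_bipartite: "\<not> partite 2 (cycle_graph (2 * g + 1))"
proof
  assume "partite 2 (cycle_graph (2 * g + 1))"
  then obtain c :: "nat \<Rightarrow> nat" where colouring: "proper_colouring (cycle_graph (2 * g + 1)) {..<2} c"
    by (auto simp: partite_iff_proper_colouring)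
  have c_less: "c j < 2" if "j \<le> 2 * g" for j
    using proper_colouring_in[OF colouring, of j] that by simp
  have "c j = (c 0 + j) mod 2" if "j \<le> 2 * g" for j
    using that
  proof (induction j)
    case 0
    then show ?case using c_less[of 0] by simp
  next
    case (Suc j)
    have "(c 0 + j) mod 2 = c j"
      using Suc by simp
    moreover have "c j \<noteq> c (Suc j)"
      using Suc.prems by (intro proper_colouring_neq[OF colouring]) (simp add: adjacent_cycle_graph)
    ultimately show ?case
      using Suc.prems c_less[of j] c_less[of "Suc j"] by (simp add: mod_Suc)
  qed
  from this[of "2 * g"] have "c (2 * g) = c 0"
    using c_less[of 0] by simp
  moreover have "c (2 * g) \<noteq> c 0"
    by (intro proper_colouring_neq[OF colouring]) (simp add: adjacent_cycle_graph)
  ultimately show False by simp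
qed

lemma generalized_odd_wheel_not_partite:
  assumes "0 < g"
  shows "\<not> partite (k + 2) (generalized_wheel k (2 * g + 1))"
proof -
  have "simple_graph (cycle_graph (2 * g + 1))"
    using assms by (intro simple_cycle_graph) simp
  then show ?thesis
    using partite_if_partite_join_complete odd_cycle_not_bipartite by blast
qed

lemma cycle_minus_vertex_bipartite:
  assumes "p < m"
  shows "partite 2 (induced_subgraph (cycle_graph m) ({..<m} - {p}))"
proof -
  define pos where "pos j = (j + (m - p)) mod m" for j
  have pos_eq_0: "j = p" if "j < m" "pos j = 0" for j
  proof -
    have "m dvd j + (m - p)" "0 < j + (m - p)" "j + (m - p) < 2 * m"
      using that assms by (auto simp: pos_def)
    moreover obtain k where multiple: "j + (m - p) = m * k"
      using \<open>m dvd j + (m - p)\<close> by (rule dvdE)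
    ultimately have "k = 1" by simp
    then show ?thesis using multiple assms by simp
  qed
  have parity: "pos i mod 2 \<noteq> pos ((i + 1) mod m) mod 2" if "i < m" "(i + 1) mod m \<noteq> p" for i
  proof -
    have "pos ((i + 1) mod m) = Suc (i + (m - p)) mod m"
      by (simp add: pos_def mod_add_left_eq)
    then have "pos ((i + 1) mod m) = (if Suc (pos i) = m then 0 else Suc (pos i))"
      by (simp add: pos_def mod_Suc)
    then have "pos ((i + 1) mod m) = Suc (pos i)"
      using pos_eq_0[of "(i + 1) mod m"] that by auto
    then show ?thesis by (simp add: mod_Suc)
  qed
  have "pos i mod 2 \<noteq> pos j mod 2" if "adjacent (cycle_graph m) i j" "i \<noteq> p" "j \<noteq> p" for i j
    using that parity[of i] parity[of j] unfolding adjacent_cycle_graph by metis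
  then have "proper_colouring (induced_subgraph (cycle_graph m) ({..<m} - {p})) {..<2} (\<lambda>j. pos j mod 2)"
    by (simp add: proper_colouring_def image_subset_iff)
  then show ?thesis
    by (auto simp: partite_iff_proper_colouring)
qed

text \<open>A graph with fewer vertices than the cycle misses one of the vertices of the cycle.\<close>

lemma partite_if_homomorphic_to_large_wheel:
  assumes simple: "simple_graph H" and hom: "homomorphic H (generalized_wheel k m)"
    and small: "card (verts H) < m"
  shows "partite (k + 2) H"
proof -
  obtain f where f_hom: "graph_hom f H (generalized_wheel k m)"
    using hom by (auto simp: homomorphic_iff_graph_hom)
  have "card (f ` verts H) < card (Inr ` {..<m} :: (nat + nat) set)"
    using small card_image_le[OF simple_graph_finite_verts[OF simple], of f] by (simp add: card_image)
  then have "\<not> Inr ` {..<m} \<subseteq> f ` verts H"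
    using card_mono[of "f ` verts H" "Inr ` {..<m}"] simple_graph_finite_verts[OF simple] by auto
  then obtain p where p_missed: "p < m" "Inr p \<notin> f ` verts H" by auto
  have f_neq: "f v \<noteq> Inr p" if "v \<in> verts H" for v
    using p_missed(2) imageI[OF that, of f] by auto
  let ?path = "induced_subgraph (cycle_graph m) ({..<m} - {p})"
  have "graph_hom f H (graph_join (complete_graph k) ?path)"
    unfolding graph_hom_def
  proof (intro conjI allI impI image_subsetI)
    fix v assume v_in: "v \<in> verts H"
    then have "f v \<in> {..<k} <+> {..<m}"
      using f_hom by (auto simp: graph_hom_def)
    then show "f v \<in> verts (graph_join (complete_graph k) ?path)"
      using f_neq[OF v_in] by (cases "f v") auto
  next
    fix u v assume uv_adjacent: "adjacent H u v"
    then have "adjacent (generalized_wheel k m) (f u) (f v)"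
      using f_hom by (simp add: graph_hom_def)
    moreover have "f u \<noteq> Inr p" "f v \<noteq> Inr p"
      using f_neq simple_graph_adjacentD(1,2)[OF simple uv_adjacent] by blast+
    ultimately show "adjacent (graph_join (complete_graph k) ?path) (f u) (f v)"
      by (cases "f u"; cases "f v") (auto simp: adjacent_cycle_graph)
  qed
  then show ?thesis
    using partite_graph_hom partite_join_complete[OF cycle_minus_vertex_bipartite[OF p_missed(1)]] by blast
qed

subsection \<open>Weighted degrees in generalized wheels\<close>

lemma neighbours_graph_join:
  "u \<in> verts G \<Longrightarrow> neighbours (graph_join G F) (Inl u) = neighbours G u <+> verts F"
  "v \<in> verts F \<Longrightarrow> neighbours (graph_join G F) (Inr v) = verts G <+> neighbours F v"
  by (auto simp: neighbours_def)

lemma neighbours_complete_graph: "i < k \<Longrightarrow> neighbours (complete_graph k) i = {..<k} - {i}"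
  by (auto simp: neighbours_def)

lemma card_neighbours_cycle_graph:
  assumes "3 \<le> m" "j < m"
  shows "card (neighbours (cycle_graph m) j) = 2"
proof -
  define pred where "pred = (if j = 0 then m - 1 else j - 1)"
  have "(i + 1) mod m = (if i + 1 = m then 0 else i + 1)" if "i < m" for i
    using that by simp
  then have pred_iff: "i < m \<and> j = (i + 1) mod m \<longleftrightarrow> i = pred" for i
    using assms by (cases "i < m") (auto simp: pred_def)
  have "(j + 1) mod m < m" using assms by simp
  then have "i \<in> neighbours (cycle_graph m) j \<longleftrightarrow> i = (j + 1) mod m \<or> i = pred" for i
    unfolding neighbours_def adjacent_cycle_graph mem_Collect_eq verts_cycle_graph lessThan_iff
    using pred_iff[of i] assms(2) by blast
  then have "neighbours (cycle_graph m) j = {(j + 1) mod m, pred}"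
    by blast
  moreover have "(j + 1) mod m \<noteq> pred"
    using assms by (cases "j + 1 = m") (auto simp: pred_def)
  ultimately show ?thesis by simp
qed

text \<open>The weights \<open>m - 2\<close> on the clique and \<open>1\<close> on the cycle make all weighted degrees equal.\<close>

definition wheel_weight :: "nat \<Rightarrow> nat + nat \<Rightarrow> nat" where
  "wheel_weight m = case_sum (\<lambda>_. m - 2) (\<lambda>_. 1)"

lemma sum_wheel_weight_Plus:
  "finite I \<Longrightarrow> finite J \<Longrightarrow> (\<Sum>x\<in>I <+> J. wheel_weight m x) = card I * (m - 2) + card J"
  by (simp add: wheel_weight_def sum.Plus)

lemma sum_wheel_weight_verts:
  "(\<Sum>x\<in>verts (generalized_wheel k m). wheel_weight m x) = k * (m - 2) + m"
  by (simp add: sum_wheel_weight_Plus)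

lemma sum_wheel_weight_neighbours:
  assumes m_ge_3: "3 \<le> m" and x_in: "x \<in> verts (generalized_wheel k m)"
  shows "(\<Sum>y\<in>neighbours (generalized_wheel k m) x. wheel_weight m y) = k * (m - 2) + 2"
proof (cases x)
  case (Inl i)
  then have "i < k" using x_in by auto
  then have "(\<Sum>y\<in>neighbours (generalized_wheel k m) x. wheel_weight m y) = (k - 1) * (m - 2) + m"
    by (simp add: Inl neighbours_graph_join neighbours_complete_graph sum_wheel_weight_Plus)
  also have "\<dots> = k * (m - 2) + 2"
    using m_ge_3 \<open>i < k\<close> by (cases k) auto
  finally show ?thesis .
next
  case (Inr j)
  then have "j < m" using x_in by auto
  moreover have "finite (neighbours (cycle_graph m) j)"
    using simple_cycle_graph[OF m_ge_3] by (rule finite_neighbours)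
  ultimately show ?thesis
    using m_ge_3
    by (simp add: Inr neighbours_graph_join sum_wheel_weight_Plus card_neighbours_cycle_graph)
qed

section \<open>Blow-ups\<close>

lemma exists_map_with_fibre_sizes:
  fixes w :: "'a \<Rightarrow> nat"
  assumes "finite X"
  obtains h :: "nat \<Rightarrow> 'a" and A where "finite A" "h ` A \<subseteq> X"
    "\<And>x. x \<in> X \<Longrightarrow> card {a \<in> A. h a = x} = w x"
proof -
  let ?S = "SIGMA x:X. {..<w x}"
  have "finite ?S" using assms by simp
  then obtain e where e_bij: "bij_betw e {0..<card ?S} ?S"
    using ex_bij_betw_nat_finite by blast
  have "card {a \<in> {0..<card ?S}. fst (e a) = x} = w x" if "x \<in> X" for x
  proof -
    have "fst (e a) = x \<longleftrightarrow> e a \<in> {x} \<times> {..<w x}" if "a \<in> {0..<card ?S}" for a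
      using bij_betwE[OF e_bij] that by fastforce
    then have "{a \<in> {0..<card ?S}. fst (e a) = x} = {a \<in> {0..<card ?S}. e a \<in> {x} \<times> {..<w x}}"
      by (intro Collect_cong conj_cong refl)
    also have "card \<dots> = card ({x} \<times> {..<w x})"
      using that by (intro bij_betw_preimage_card[OF e_bij]) auto
    finally show ?thesis by simp
  qed
  moreover have "(\<lambda>a. fst (e a)) ` {0..<card ?S} \<subseteq> X"
    using bij_betwE[OF e_bij] by fastforce
  ultimately show ?thesis
    using that[of "{0..<card ?S}" "\<lambda>a. fst (e a)"] by simp
qed

lemma card_preimage_eq_sum_fibres:
  assumes "finite A" "finite X"
  shows "card {a \<in> A. h a \<in> X} = (\<Sum>x\<in>X. card {a \<in> A. h a = x})"
proof -
  have "{a \<in> A. h a \<in> X} = (\<Union>x\<in>X. {a \<in> A. h a = x})" by auto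
  then show ?thesis
    using assms by (simp only:) (intro card_UN_disjoint; auto)
qed

lemma degree_pullback_graph:
  assumes "simple_graph B" "finite A" "h ` A \<subseteq> verts B" "a \<in> A"
  shows "degree (pullback_graph B h A) a = (\<Sum>x\<in>neighbours B (h a). card {b \<in> A. h b = x})"
proof -
  have "neighbours (pullback_graph B h A) a = {b \<in> A. h b \<in> neighbours B (h a)}"
    using assms(3,4) by (auto simp: neighbours_def)
  then show ?thesis
    using assms(1,2)
    by (simp add: degree_eq_card_neighbours card_preimage_eq_sum_fibres finite_neighbours)
qed

text \<open>Giving each vertex of \<open>B\<close> the majority colour of its fibre cannot colour \<open>B\<close> properly, and all
  edges between the majority classes of two adjacent fibres with the same colour have to be deleted.\<close>

lemma blow_up_far_from_partite:
  assumes B_not_partite: "simple_graph B" "\<not> partite r B" and A_finite: "finite A"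
    and fibre: "\<And>x. x \<in> verts B \<Longrightarrow> q \<le> card {a \<in> A. h a = x}" and r_pos: "0 < r"
    and D_partite: "finite D"
      "partite r ((pullback_graph B h A)\<lparr>edges := edges (pullback_graph B h A) - D\<rparr>)"
  shows "q\<^sup>2 \<le> r\<^sup>2 * card D"
proof -
  obtain c where colouring: "c ` A \<subseteq> {..<r}"
    "\<And>u v. adjacent (pullback_graph B h A) u v \<Longrightarrow> {u, v} \<notin> D \<Longrightarrow> c u \<noteq> c v"
    using D_partite(2) by (auto simp: partite_iff_proper_colouring proper_colouring_def adjacent_def)
  define M where "M x i = c -` {i} \<inter> {a \<in> A. h a = x}" for x i
  have "\<exists>i\<in>{..<r}. q \<le> card (M x i) * r" if "x \<in> verts B" for x
    using pigeonhole_card[of c "{a \<in> A. h a = x}" "{..<r}"] colouring(1) A_finite r_pos fibre[OF that]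
    unfolding M_def
    by (fastforce intro: order_trans)
  then obtain k where k_majority: "\<And>x. x \<in> verts B \<Longrightarrow> k x \<in> {..<r} \<and> q \<le> card (M x (k x)) * r"
    by metis
  have "\<not> proper_colouring B {..<r} k"
    using B_not_partite(2) by (auto simp: partite_iff_proper_colouring)
  then obtain x y where same_majority: "adjacent B x y" "k x = k y"
    using k_majority by (auto simp: proper_colouring_def)
  have xy_in: "x \<in> verts B" "y \<in> verts B" "x \<noteq> y"
    using simple_graph_adjacentD[OF B_not_partite(1) same_majority(1)] by auto
  let ?P = "M x (k x) \<times> M y (k y)"
  have "inj_on (\<lambda>(a, b). {a, b}) ?P"
    using xy_in(3) by (auto simp: M_def inj_on_def doubleton_eq_iff)
  moreover have "{a, b} \<in> D" if "a \<in> M x (k x)" "b \<in> M y (k y)" for a b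
    using colouring(2)[of a b] that same_majority by (auto simp: M_def)
  then have "(\<lambda>(a, b). {a, b}) ` ?P \<subseteq> D"
    by auto
  ultimately have "card ?P \<le> card D"
    using D_partite(1) by (rule card_inj_on_le)
  have "q * q \<le> (card (M x (k x)) * r) * (card (M y (k y)) * r)"
    using k_majority xy_in(1,2) by (intro mult_mono) auto
  also have "\<dots> = r\<^sup>2 * card ?P"
    by (simp add: card_cartesian_product power2_eq_square)
  also have "\<dots> \<le> r\<^sup>2 * card D"
    using \<open>card ?P \<le> card D\<close> by (rule mult_le_mono2)
  finally show ?thesis
    by (simp add: power2_eq_square)
qed

lemma blow_up_not_partite_after_deleting:
  fixes t :: real
  assumes "simple_graph B" "\<not> partite r B" "finite A"
    and "\<And>x. x \<in> verts B \<Longrightarrow> q \<le> card {a \<in> A. h a = x}" and r_pos: "0 < r"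
    and t_small: "(real r)\<^sup>2 * t < (real q)\<^sup>2"
  shows "\<not> partite_after_deleting r t (pullback_graph B h A)"
proof
  let ?G = "pullback_graph B h A"
  assume "partite_after_deleting r t ?G"
  then obtain D where deleted: "D \<subseteq> edges ?G" "card D \<le> t" "partite r (?G\<lparr>edges := edges ?G - D\<rparr>)"
    unfolding partite_after_deleting_def by blast
  have "finite (edges ?G)"
    using assms(1,3) by (intro simple_graph_finite_edges simple_pullback_graph)
  with deleted(1) have "finite D"
    by (rule finite_subset)
  then have "q\<^sup>2 \<le> r\<^sup>2 * card D"
    using blow_up_far_from_partite[OF assms(1-4) r_pos _ deleted(3)] by simp
  then have "(real q)\<^sup>2 \<le> (real r)\<^sup>2 * card D"
    by (simp flip: of_nat_mult of_nat_power)
  also have "\<dots> \<le> (real r)\<^sup>2 * t"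
    using deleted(2) by (intro mult_left_mono) auto
  finally show False using t_small by simp
qed

lemma exists_regular_blow_up_of_generalized_wheel:
  assumes m_ge_3: "3 \<le> m" and q_pos: "0 < q"
  obtains h :: "nat \<Rightarrow> nat + nat" and A where "finite A" "h ` A \<subseteq> verts (generalized_wheel k m)"
    "\<And>x. x \<in> verts (generalized_wheel k m) \<Longrightarrow> q \<le> card {a \<in> A. h a = x}"
    "card A = (k * (m - 2) + m) * q"
    "min_degree (pullback_graph (generalized_wheel k m) h A) = (k * (m - 2) + 2) * q"
proof -
  let ?B = "generalized_wheel k m"
  have simple: "simple_graph ?B" using m_ge_3 by (rule simple_generalized_wheel)
  then have "finite (verts ?B)" by (rule simple_graph_finite_verts)
  then obtain h :: "nat \<Rightarrow> nat + nat" and A where A_finite: "finite A" "h ` A \<subseteq> verts ?B"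
    and fibre: "\<And>x. x \<in> verts ?B \<Longrightarrow> card {a \<in> A. h a = x} = wheel_weight m x * q"
    by (rule exists_map_with_fibre_sizes[where w = "\<lambda>x. wheel_weight m x * q"]) (rule that)
  have sum_fibres: "(\<Sum>x\<in>X. card {a \<in> A. h a = x}) = (\<Sum>x\<in>X. wheel_weight m x) * q" if "X \<subseteq> verts ?B" for X
    using fibre that by (simp add: sum_distrib_right subset_iff)
  have "card A = card {a \<in> A. h a \<in> verts ?B}"
    using A_finite(2) by (intro arg_cong[where f = card]) auto
  also have "\<dots> = (k * (m - 2) + m) * q"
    unfolding card_preimage_eq_sum_fibres[OF A_finite(1) \<open>finite (verts ?B)\<close>] sum_fibres[OF order_refl]
      sum_wheel_weight_verts ..
  finally have card_A: "card A = (k * (m - 2) + m) * q" .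
  have "degree (pullback_graph ?B h A) a = (k * (m - 2) + 2) * q" if "a \<in> A" for a
  proof -
    have "neighbours ?B (h a) \<subseteq> verts ?B" "h a \<in> verts ?B"
      using A_finite(2) that by (auto simp: neighbours_def)
    then show ?thesis
      using degree_pullback_graph[OF simple A_finite that] sum_fibres
        sum_wheel_weight_neighbours[OF m_ge_3] by simp
  qed
  moreover have "A \<noteq> {}"
    using card_A m_ge_3 q_pos by auto
  ultimately have "min_degree (pullback_graph ?B h A) = (k * (m - 2) + 2) * q"
    by (simp add: min_degree_def image_constant_conv)
  moreover have "q \<le> card {a \<in> A. h a = x}" if "x \<in> verts ?B" for x
    using fibre[OF that] m_ge_3 by (cases x) (auto simp: wheel_weight_def)
  ultimately show ?thesis
    using that A_finite card_A by blast
qed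

section \<open>The threshold\<close>

lemma partite_chromatic_number: "simple_graph G \<Longrightarrow> partite (chromatic_number G) G"
  unfolding chromatic_number_def by (rule LeastI) (rule partite_card_verts)

lemma not_partite_if_less_chromatic_number: "k < chromatic_number G \<Longrightarrow> \<not> partite k G"
  unfolding chromatic_number_def by (rule not_less_Least)

definition admissible_density :: "'a graph \<Rightarrow> real \<Rightarrow> bool" where
  "admissible_density H c \<longleftrightarrow> (\<forall>\<eta>>0. \<exists>n\<^sub>0. \<forall>G :: nat graph.
     simple_graph G \<longrightarrow> graph_free H G \<longrightarrow> n\<^sub>0 \<le> card (verts G) \<longrightarrow>
     c * real (card (verts G)) \<le> real (min_degree G) \<longrightarrow>
     partite_after_deleting (chromatic_number H - 1) (\<eta> * (real (card (verts G)))\<^sup>2) G)"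

lemma delta_threshold_eq_Inf: "delta_threshold H = Inf {c. admissible_density H c}"
  by (simp add: delta_threshold_def admissible_density_def)

lemma delta_threshold_bounds:
  assumes lower: "\<And>c. admissible_density H c \<Longrightarrow> l \<le> c" and upper: "\<And>c. u < c \<Longrightarrow> admissible_density H c"
  shows "l \<le> delta_threshold H" "delta_threshold H \<le> u"
proof -
  let ?S = "{c. admissible_density H c}"
  have "u + 1 \<in> ?S" using upper by simp
  then show "l \<le> delta_threshold H"
    unfolding delta_threshold_eq_Inf using lower by (intro cInf_greatest) auto
  have "bdd_below ?S"
    using lower by (intro bdd_belowI[of _ l]) simp
  then have "Inf ?S \<le> Inf {u<..}"
    using upper by (intro cInf_superset_mono) auto
  then show "delta_threshold H \<le> u"
    by (simp add: delta_threshold_eq_Inf)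
qed

lemma admissible_density_if_greater:
  assumes "simple_graph H" "chromatic_number H = r + 1" "2 \<le> r" "1 - 1 / (real r - 1 / 3) < c"
  shows "admissible_density H c"
  unfolding admissible_density_def assms(2)
  using minimum_degree_stability[where 'b = nat, of H r c] partite_chromatic_number[OF assms(1)] assms
  by simp

lemma exists_dense_graph_far_from_partite:
  fixes k g n\<^sub>0 :: nat
  assumes simple: "simple_graph H" and g_pos: "0 < g"
    and nonhom: "\<not> homomorphic H (generalized_wheel k (2 * g + 1))"
  defines "d \<equiv> k * (2 * g + 1 - 2) + 2" and "N \<equiv> k * (2 * g + 1 - 2) + (2 * g + 1)"
  obtains G :: "nat graph" where "simple_graph G" "graph_free H G" "n\<^sub>0 \<le> card (verts G)"
    "min_degree G = real d / real N * card (verts G)"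
    "\<not> partite_after_deleting (k + 2) (1 / (2 * (real (k + 2) * N)\<^sup>2) * (real (card (verts G)))\<^sup>2) G"
proof -
  let ?W = "generalized_wheel k (2 * g + 1)"
  define q where "q = Suc n\<^sub>0"
  have q_bounds: "0 < q" "3 \<le> 2 * g + 1" using g_pos by (simp_all add: q_def)
  have N_pos: "0 < N" by (simp add: N_def)
  have W_not_partite: "simple_graph ?W" "\<not> partite (k + 2) ?W"
    using q_bounds(2) g_pos simple_generalized_wheel generalized_odd_wheel_not_partite by blast+
  obtain h :: "nat \<Rightarrow> nat + nat" and A where A_finite: "finite A" "h ` A \<subseteq> verts ?W"
    and fibre: "\<And>x. x \<in> verts ?W \<Longrightarrow> q \<le> card {a \<in> A. h a = x}"
    and card_A: "card A = N * q" and degree: "min_degree (pullback_graph ?W h A) = d * q"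
    by (rule exists_regular_blow_up_of_generalized_wheel[OF q_bounds(2,1), of k, folded d_def N_def])
      (rule that)
  let ?G = "pullback_graph ?W h A"
  show ?thesis
  proof (rule that)
    show "simple_graph ?G" using W_not_partite(1) A_finite(1) by (rule simple_pullback_graph)
    show "graph_free H ?G" using simple nonhom A_finite(2) by (rule graph_free_pullback_graph)
    have "n\<^sub>0 \<le> q" by (simp add: q_def)
    also have "q \<le> N * q" using N_pos by simp
    finally show "n\<^sub>0 \<le> card (verts ?G)" by (simp add: card_A)
    show "min_degree ?G = real d / real N * card (verts ?G)"
      unfolding verts_pullback_graph degree card_A using N_pos by simp
    have "(real (k + 2))\<^sup>2 * (1 / (2 * (real (k + 2) * N)\<^sup>2) * (real (card (verts ?G)))\<^sup>2) = (real q)\<^sup>2 / 2"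
      unfolding verts_pullback_graph card_A using N_pos by (simp add: power_mult_distrib del: of_nat_add)
    also have "\<dots> < (real q)\<^sup>2" using q_bounds(1) by simp
    finally show "\<not> partite_after_deleting (k + 2)
        (1 / (2 * (real (k + 2) * N)\<^sup>2) * (real (card (verts ?G)))\<^sup>2) ?G"
      using blow_up_not_partite_after_deleting[OF W_not_partite A_finite(1) fibre] by simp
  qed
qed

lemma admissible_density_greater_wheel_density:
  fixes k g :: nat
  assumes H_chromatic: "simple_graph H" "chromatic_number H = k + 3" and g_pos: "0 < g"
    and nonhom: "\<not> homomorphic H (generalized_wheel k (2 * g + 1))"
    and admissible: "admissible_density H c"
  shows "real (k * (2 * g + 1 - 2) + 2) / real (k * (2 * g + 1 - 2) + (2 * g + 1)) < c"
proof (rule ccontr)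
  let ?d = "k * (2 * g + 1 - 2) + 2" and ?N = "k * (2 * g + 1 - 2) + (2 * g + 1)"
  assume "\<not> real ?d / real ?N < c"
  then have c_le: "c \<le> real ?d / real ?N" by simp
  have "0 < real (k + 2) * real ?N"
    by (intro mult_pos_pos of_nat_0_less_iff[THEN iffD2]) simp_all
  then have "0 < 1 / (2 * (real (k + 2) * ?N)\<^sup>2)"
    by (simp only: zero_less_divide_1_iff zero_less_mult_iff zero_less_power) simp
  then obtain n\<^sub>0 where partite_if_large: "\<forall>G :: nat graph.
      simple_graph G \<longrightarrow> graph_free H G \<longrightarrow> n\<^sub>0 \<le> card (verts G) \<longrightarrow>
      c * real (card (verts G)) \<le> real (min_degree G) \<longrightarrow>
      partite_after_deleting (chromatic_number H - 1)
        (1 / (2 * (real (k + 2) * ?N)\<^sup>2) * (real (card (verts G)))\<^sup>2) G"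
    using admissible unfolding admissible_density_def by blast
  obtain G :: "nat graph" where G_large: "simple_graph G" "graph_free H G" "n\<^sub>0 \<le> card (verts G)"
    and degree: "min_degree G = real ?d / real ?N * card (verts G)"
    and far: "\<not> partite_after_deleting (k + 2)
      (1 / (2 * (real (k + 2) * ?N)\<^sup>2) * (real (card (verts G)))\<^sup>2) G"
    by (rule exists_dense_graph_far_from_partite[OF H_chromatic(1) g_pos nonhom])
  have "c * real (card (verts G)) \<le> real (min_degree G)"
    unfolding degree using c_le by (intro mult_right_mono) auto
  moreover have "chromatic_number H - 1 = k + 2" using H_chromatic(2) by simp
  ultimately show False
    using partite_if_large G_large far by metis
qed

lemma generalized_wheel_density:
  assumes "2 \<le> r" "0 < g"
  shows "1 - 1 / (real r - 1 + 2 / (2 * real g - 1))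
    = real ((r - 2) * (2 * g + 1 - 2) + 2) / real ((r - 2) * (2 * g + 1 - 2) + (2 * g + 1))"
proof -
  define x where "x = 2 * real g - 1"
  have x_pos: "0 < x" "real (2 * g - 1) = x" "real (2 * g + 1) = x + 2"
    using assms(2) by (auto simp: x_def)
  have "0 < (real r - 1) * x + 2"
    using assms(1) x_pos(1) by (intro add_nonneg_pos mult_nonneg_nonneg) auto
  then have "1 - 1 / (real r - 1 + 2 / x) = ((real r - 2) * x + 2) / ((real r - 2) * x + (x + 2))"
    using x_pos(1) by (simp add: field_simps)
  then show ?thesis
    using assms(1) x_pos(2,3) by (simp add: x_def ac_simps)
qed

lemma exists_least_wheel_not_homomorphic:
  assumes "simple_graph H" "\<not> partite (k + 2) H"
  obtains g where "0 < g" "\<not> homomorphic H (generalized_wheel k (2 * g + 1))"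
    "\<And>g'. 0 < g' \<Longrightarrow> g' < g \<Longrightarrow> homomorphic H (generalized_wheel k (2 * g' + 1))"
proof -
  let ?P = "\<lambda>g. 0 < g \<and> \<not> homomorphic H (generalized_wheel k (2 * g + 1))"
  have "?P (Suc (card (verts H)))"
    using partite_if_homomorphic_to_large_wheel[OF assms(1)] assms(2) by fastforce
  then obtain g where "?P g" "\<And>g'. g' < g \<Longrightarrow> \<not> ?P g'"
    using exists_least_iff[of ?P] by blast
  then show ?thesis using that by blast
qed

theorem theorem3p1:
  fixes H :: "'a graph" and r :: nat
  assumes "simple_graph H"
    and "chromatic_number H = r + 1"
    and "r + 1 \<ge> 3"
  shows "\<exists>g :: nat. g > 0 \<and>
      \<not> homomorphic H (graph_join (complete_graph (r - 2)) (cycle_graph (2 * g + 1))) \<and>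
      (\<forall>g'. 0 < g' \<and> g' < g \<longrightarrow>
        homomorphic H (graph_join (complete_graph (r - 2)) (cycle_graph (2 * g' + 1)))) \<and>
      1 - 1 / (real r - 1) < 1 - 1 / (real r - 1 + 2 / (2 * real g - 1)) \<and>
      1 - 1 / (real r - 1 + 2 / (2 * real g - 1)) \<le> delta_threshold H \<and>
      delta_threshold H \<le> 1 - 1 / (real r - 1 / 3)"
proof -
  have r_ge_2: "2 \<le> r" "r - 2 + 2 = r" and chromatic: "chromatic_number H = r - 2 + 3"
    using assms(2,3) by simp_all
  have "\<not> partite (r - 2 + 2) H"
    unfolding r_ge_2(2) using assms(2) by (intro not_partite_if_less_chromatic_number) simp
  then obtain g where g_nonhom: "0 < g" "\<not> homomorphic H (generalized_wheel (r - 2) (2 * g + 1))"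
    and least: "\<And>g'. 0 < g' \<Longrightarrow> g' < g \<Longrightarrow> homomorphic H (generalized_wheel (r - 2) (2 * g' + 1))"
    using exists_least_wheel_not_homomorphic[OF assms(1)] by blast
  let ?lower = "1 - 1 / (real r - 1 + 2 / (2 * real g - 1))" and ?upper = "1 - 1 / (real r - 1 / 3)"
  have "?lower \<le> c" if "admissible_density H c" for c
    unfolding generalized_wheel_density[OF r_ge_2(1) g_nonhom(1)]
    using admissible_density_greater_wheel_density[OF assms(1) chromatic g_nonhom that] by simp
  moreover have "admissible_density H c" if "?upper < c" for c
    using assms(1,2) r_ge_2(1) that by (rule admissible_density_if_greater)
  ultimately have "?lower \<le> delta_threshold H" "delta_threshold H \<le> ?upper"
    using delta_threshold_bounds[of H ?lower ?upper] by blast+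
  moreover have "1 - 1 / (real r - 1) < ?lower"
    using r_ge_2(1) g_nonhom(1)
    by (intro diff_strict_left_mono divide_strict_left_mono mult_pos_pos add_pos_pos) auto
  ultimately show ?thesis
    using g_nonhom least by blast
qed

end
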